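(* Let $f_1,f_2,u_1,u_2\in\mathbb{R}$ with $f_1\ge0$ and $f_1+f_2\ge0$, not both zero, and $u_2<0$. Let $$f_0(x)=f_1+f_2\,\theta(x),\qquad u_0(x)=u_1+u_2\,\theta(x),\qquad x\in\mathbb{R},$$ where $\theta$ is the Heaviside function. Let $(f(t,x),u(t,x))$ be the generalized solution, in the sense of free particles, of the Riemann problem for the pressureless gas dynamics system $$\partial_t f+\partial_x(fu)=0,\qquad \partial_t(fu)+\partial_x(fu^2)=0$$ with initial data $(f_0,u_0)$. Then $(f,u)$ in fact solves, in the sense of integral identities (distributions) for $t>0$, $x\in\mathbb{R}$, the gas dynamics system with pressure $$\partial_t f+\partial_x(fu)=0,\qquad \partial_t(fu)+\partial_x(fu^2+p)=0,$$ where $$p(t,x)=\frac{f_1(f_1+f_2)\,u_2^2}{2f_1+f_2}\Big(\theta\big(x-(u_1+u_2)t\big)-\theta\big(x-u_1t\big)\Big).$$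
   Context: Definition (generalized solution in the sense of free particles). Let $f_0(x)=f_1+f_2\,\theta(x)$ and $u_0(x)=u_1+u_2\,\theta(x)$, $x\in\mathbb{R}$, where $\theta$ is the Heaviside function and $f_1,f_2,u_1,u_2\in\mathbb{R}$ with $f_1\ge0$ and $f_1+f_2\ge0$, not both zero, and $u_2<0$. The couple $(f(t,x),u(t,x))$ is called the generalized solution of the Riemann problem $$\partial_t f+\partial_x(fu)=0,\qquad \partial_t(fu)+\partial_x(fu^2)=0,\qquad f(0,x)=f_0(x),\quad u(0,x)=u_0(x)$$ in the sense of free particles if for almost all $(t,x)\in\mathbb{R}_+\times\mathbb{R}$ $$f(t,x)=\lim_{\varepsilon\to0}\Big(\lim_{\sigma\to0}\rho^\varepsilon(t,x)\Big),\qquad u(t,x)=\lim_{\varepsilon\to0}\Big(\lim_{\sigma\to0}\hat u^\varepsilon(t,x)\Big),$$ where $(\rho^\varepsilon,\hat u^\varepsilon)$ (depending also on $\sigma>0$) satisfy the system $$\partial_t\rho+\partial_x(\rho\hat u)=\tfrac12\sigma^2\partial_{xx}\rho,\qquad \partial_t(\rho\hat u)+\partial_x(\rho\hat u^2)=-\int_{\mathbb{R}}(u-\hat u)^2\,\partial_xP\,du+\tfrac12\sigma^2\partial_{xx}(\rho\hat u)$$ with smoothed initial data $(f_0^\varepsilon,u_0^\varepsilon)$ of class $C^1(\mathbb{R})$ such that $f_0^\varepsilon\to f_0$ and $u_0^\varepsilon\to u_0$ as $\varepsilon\to0$ for almost all fixed $x$. Here $f_0^\varepsilon\ge0$ is not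 identically zero, and $P=P(t,x,u)$ is the solution of the Fokker–Planck equation $\partial_tP=-u\,\partial_xP+\tfrac12\sigma^2\partial_{xx}P$ with $P(0,x,u)=\delta(u-u_0^\varepsilon(x))f_0^\varepsilon(x)$. Moreover $\rho=\int_{\mathbb{R}} P\,du$ and $\hat u=\int_{\mathbb{R}} uP\,du\big/\int_{\mathbb{R}} P\,du$. Explicitly, for $t>0$, $$\rho^\varepsilon(t,x)=\frac1{\sqrt{2\pi t}\,\sigma}\int_{\mathbb{R}}f_0^\varepsilon(s)e^{-\frac{|u_0^\varepsilon(s)t+s-x|^2}{2\sigma^2t}}ds,\qquad \hat u^\varepsilon(t,x)=\frac{\int_{\mathbb{R}}u_0^\varepsilon(s)f_0^\varepsilon(s)e^{-\frac{|u_0^\varepsilon(s)t+s-x|^2}{2\sigma^2t}}ds}{\int_{\mathbb{R}}f_0^\varepsilon(s)e^{-\frac{|u_0^\varepsilon(s)t+s-x|^2}{2\sigma^2t}}ds}.$$ The generalized solution is regarded as independent of the choice of the smoothed data $(f_0^\varepsilon,u_0^\varepsilon)$ (bounded and of class $C^1$). For piecewise smooth functions, solving the system with pressure in the sense of integral identities means on jumps moving with velocity $D$ the Hugoniot conditions $[f]D=[fu]$ and $[fu]D=[fu^2+p]$, where $[h(y)]=h(y+0)-h(y-0)$.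
   Formalization: The smoothed data are required to be bounded uniformly in ε, with the variation of u_0^ε tending to 0 on intervals away from the jump; for arbitrary bounded C^1 data converging almost everywhere the generalized solution depends on the smoothing and the claim can fail. *)

theory Defs
  imports "HOL-Analysis.Analysis"
begin

definition heaviside :: "real \<Rightarrow> real" where
  "heaviside x = (if x < 0 then 0 else 1)"

definition riemann_data :: "real \<Rightarrow> real \<Rightarrow> real \<Rightarrow> real" where
  "riemann_data a b x = a + b * heaviside x"


section \<open>Stochastically perturbed free particles\<close>

text \<open>
  The moments \<open>\<integral> P du\<close> and \<open>\<integral> u P du / \<integral> P du\<close> of the solution \<open>P\<close> of the Fokker--Planck equation
  \<open>P\<^sub>t = - u P\<^sub>x + (\<sigma>\<^sup>2 / 2) P\<^sub>x\<^sub>x\<close> with \<open>P(0, x, u) = \<delta>(u - U(x)) F(x)\<close>, that is, of the superposition over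
  \<open>s\<close> of the particles that start at \<open>s\<close> with velocity \<open>U(s)\<close> and weight \<open>F(s)\<close> and whose position
  at time \<open>t\<close> is normally distributed with mean \<open>s + U(s) t\<close> and variance \<open>\<sigma>\<^sup>2 t\<close>.
\<close>

definition particle_density ::
  "(real \<Rightarrow> real) \<Rightarrow> (real \<Rightarrow> real) \<Rightarrow> real \<Rightarrow> real \<Rightarrow> real \<Rightarrow> real" where
  "particle_density F U \<sigma> t x =
     1 / (sqrt (2 * pi * t) * \<sigma>) *
     (LBINT s. F s * exp (- (\<bar>U s * t + s - x\<bar>\<^sup>2 / (2 * \<sigma>\<^sup>2 * t))))"

definition particle_velocity ::
  "(real \<Rightarrow> real) \<Rightarrow> (real \<Rightarrow> real) \<Rightarrow> real \<Rightarrow> real \<Rightarrow> real \<Rightarrow> real" where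
  "particle_velocity F U \<sigma> t x =
     (LBINT s. U s * F s * exp (- (\<bar>U s * t + s - x\<bar>\<^sup>2 / (2 * \<sigma>\<^sup>2 * t)))) /
     (LBINT s. F s * exp (- (\<bar>U s * t + s - x\<bar>\<^sup>2 / (2 * \<sigma>\<^sup>2 * t))))"


section \<open>Smoothed initial data\<close>

text \<open>
  \<open>F \<epsilon>\<close> and \<open>U \<epsilon>\<close> are the smoothed density and velocity for the parameter \<open>\<epsilon> > 0\<close>.  Convergence almost
  everywhere alone does not determine the limits below, so two conditions make precise what a
  smoothing of a single jump is.
  The bound is uniform in \<open>\<epsilon>\<close>; otherwise \<open>F \<epsilon>\<close> may put a fixed mass into a shrinking neighbourhood
  of the jump, and that mass spreads over the sector between the two rays.
  The variation of \<open>U \<epsilon>\<close> over an interval not containing the jump tends to 0, the variation of the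
  limit there; otherwise \<open>U \<epsilon>\<close> may have vanishing oscillations that fold the particle paths, as
  in the construction of Besicovitch sets, so that the density concentrates on sets of small
  measure and its pointwise limit loses mass.  The last condition holds if \<open>U \<epsilon>\<close> is monotone, if
  \<open>U \<epsilon>\<close> is the convolution of the jump with a rescaled integrable kernel, and if \<open>U \<epsilon>\<close> differs from
  the jump only on a shrinking neighbourhood of 0.
\<close>

definition smoothed_data ::
  "(real \<Rightarrow> real) \<Rightarrow> (real \<Rightarrow> real) \<Rightarrow>
   (real \<Rightarrow> real \<Rightarrow> real) \<Rightarrow> (real \<Rightarrow> real \<Rightarrow> real) \<Rightarrow> bool" where
  "smoothed_data f\<^sub>0 u\<^sub>0 F U \<longleftrightarrow>
     (\<forall>\<epsilon>>0. F \<epsilon> C1_differentiable_on UNIV \<and> U \<epsilon> C1_differentiable_on UNIV) \<and>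
     (\<forall>\<epsilon>>0. (\<forall>x. 0 \<le> F \<epsilon> x) \<and> (\<exists>x. F \<epsilon> x \<noteq> 0)) \<and>
     (\<exists>M. \<forall>\<epsilon>>0. \<forall>x. \<bar>F \<epsilon> x\<bar> \<le> M \<and> \<bar>U \<epsilon> x\<bar> \<le> M) \<and>
     (AE x in lborel. ((\<lambda>\<epsilon>. F \<epsilon> x) \<longlongrightarrow> f\<^sub>0 x) (at_right 0)) \<and>
     (AE x in lborel. ((\<lambda>\<epsilon>. U \<epsilon> x) \<longlongrightarrow> u\<^sub>0 x) (at_right 0)) \<and>
     (\<forall>a b. a < b \<and> 0 \<notin> {a..b} \<longrightarrow>
        ((\<lambda>\<epsilon>. LBINT s:{a..b}. \<bar>deriv (U \<epsilon>) s\<bar>) \<longlongrightarrow> 0) (at_right 0))"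


section \<open>Generalized solutions in the sense of free particles\<close>

text \<open>\<open>l = lim\<^bsub>\<epsilon>\<rightarrow>0\<^esub> (lim\<^bsub>\<sigma>\<rightarrow>0\<^esub> h \<epsilon> \<sigma>)\<close>, existence of the limits included.\<close>

definition has_iterated_limit :: "(real \<Rightarrow> real \<Rightarrow> real) \<Rightarrow> real \<Rightarrow> bool" where
  "has_iterated_limit h l \<longleftrightarrow>
     (\<exists>H. (\<forall>\<^sub>F \<epsilon> in at_right 0. (h \<epsilon> \<longlongrightarrow> H \<epsilon>) (at_right 0)) \<and> (H \<longlongrightarrow> l) (at_right 0))"

text \<open>
  The smoothed data are quantified existentially: what is proved about generalized solutions then
  holds for every choice of the smoothing for which the limits exist.
\<close>

definition generalized_solution ::
  "(real \<Rightarrow> real) \<Rightarrow> (real \<Rightarrow> real) \<Rightarrow>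
   (real \<Rightarrow> real \<Rightarrow> real) \<Rightarrow> (real \<Rightarrow> real \<Rightarrow> real) \<Rightarrow> bool" where
  "generalized_solution f\<^sub>0 u\<^sub>0 f u \<longleftrightarrow>
     (\<exists>F U. smoothed_data f\<^sub>0 u\<^sub>0 F U \<and>
        (AE (t, x) in lborel. 0 < t \<longrightarrow>
           has_iterated_limit (\<lambda>\<epsilon> \<sigma>. particle_density (F \<epsilon>) (U \<epsilon>) \<sigma> t x) (f t x) \<and>
           has_iterated_limit (\<lambda>\<epsilon> \<sigma>. particle_velocity (F \<epsilon>) (U \<epsilon>) \<sigma> t x) (u t x)))"


section \<open>Conservation laws in the sense of distributions\<close>

definition dt :: "(real \<times> real \<Rightarrow> real) \<Rightarrow> real \<times> real \<Rightarrow> real" where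
  "dt \<phi> = (\<lambda>(t, x). deriv (\<lambda>s. \<phi> (s, x)) t)"

definition dx :: "(real \<times> real \<Rightarrow> real) \<Rightarrow> real \<times> real \<Rightarrow> real" where
  "dx \<phi> = (\<lambda>(t, x). deriv (\<lambda>y. \<phi> (t, y)) x)"

primrec Ck :: "nat \<Rightarrow> (real \<times> real \<Rightarrow> real) \<Rightarrow> bool" where
  "Ck 0 \<phi> \<longleftrightarrow> continuous_on UNIV \<phi>"
| "Ck (Suc n) \<phi> \<longleftrightarrow> (\<forall>z. \<phi> differentiable (at z)) \<and> Ck n (dt \<phi>) \<and> Ck n (dx \<phi>)"

definition half_plane :: "(real \<times> real) set" where
  "half_plane = {0<..} \<times> UNIV"

definition test_function :: "(real \<times> real \<Rightarrow> real) \<Rightarrow> bool" where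
  "test_function \<phi> \<longleftrightarrow>
     (\<forall>n. Ck n \<phi>) \<and> compact (closure {z. \<phi> z \<noteq> 0}) \<and> closure {z. \<phi> z \<noteq> 0} \<subseteq> half_plane"

definition locally_integrable :: "(real \<Rightarrow> real \<Rightarrow> real) \<Rightarrow> bool" where
  "locally_integrable q \<longleftrightarrow>
     (\<forall>K. compact K \<and> K \<subseteq> half_plane \<longrightarrow> set_integrable lebesgue K (\<lambda>(t, x). q t x))"

text \<open>\<open>q\<^sub>t + j\<^sub>x = 0\<close> in the sense of distributions on \<open>t > 0\<close>.\<close>

definition weak_conservation_law ::
  "(real \<Rightarrow> real \<Rightarrow> real) \<Rightarrow> (real \<Rightarrow> real \<Rightarrow> real) \<Rightarrow> bool" where
  "weak_conservation_law q j \<longleftrightarrow>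
     locally_integrable q \<and> locally_integrable j \<and>
     (\<forall>\<phi>. test_function \<phi> \<longrightarrow>
        (LINT (t, x)|lebesgue. q t x * dt \<phi> (t, x) + j t x * dx \<phi> (t, x)) = 0)"

definition solves_gas_dynamics_with_pressure ::
  "(real \<Rightarrow> real \<Rightarrow> real) \<Rightarrow> (real \<Rightarrow> real \<Rightarrow> real) \<Rightarrow> (real \<Rightarrow> real \<Rightarrow> real) \<Rightarrow> bool" where
  "solves_gas_dynamics_with_pressure f u p \<longleftrightarrow>
     weak_conservation_law f (\<lambda>t x. f t x * u t x) \<and>
     weak_conservation_law (\<lambda>t x. f t x * u t x) (\<lambda>t x. f t x * (u t x)\<^sup>2 + p t x)"

end

theory Submission
  imports Defs "HOL-Probability.Distributions"
begin

text \<open>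
  In the limit the particles to the left of the jump form a stream of density \<open>f\<^sub>1\<close> and velocity \<open>u\<^sub>1\<close>, those to
  the right a stream of density \<open>f\<^sub>1 + f\<^sub>2\<close> and velocity \<open>u\<^sub>1 + u\<^sub>2 < u\<^sub>1\<close>, and the two streams pass through
  each other.  Hence \<open>f\<close> is the sum of the two densities and \<open>f u\<close> the sum of the two momenta.  Mass,
  momentum and momentum flux of a single stream are constant along its own characteristics, so every such
  sum satisfies a conservation law (\<open>weak_conservation_law_two_streams\<close>).  The sum of the two momentum
  fluxes exceeds \<open>f u\<^sup>2\<close> exactly by the pressure (\<open>two_streams_pressure\<close>).

  The analytic content is the identification of the iterated limits of the density and of the momentum
  (\<open>jump_smoothing.density_eq_two_streams\<close>).  For a weight \<open>W\<close> and the flow map \<open>X s = s + t U s\<close>, the noisy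
  density is the image of \<open>W ds\<close> under \<open>X\<close> smeared by a Gaussian.  If the weight is \<open>X'\<close> on an interval
  \<open>[a, b]\<close> and 0 elsewhere, the substitution rule turns this into the Gaussian mass of \<open>[X a, X b]\<close>, which
  tends to an indicator.  Away from the jump the given weight is \<open>L\<^sup>1\<close>-close to a constant times \<open>X'\<close>, since
  the variation of \<open>U\<close> is small there; close to the jump its mass is small because it is bounded.  Smearing
  does not increase the \<open>L\<^sup>1\<close> norm, so by Fatou's lemma the pointwise limits inherit the \<open>L\<^sup>1\<close> bounds and
  must be the two-stream density.  The folds and caustics of the flow for a fixed smoothing enter only through
  their mass.
\<close>

section \<open>Upper integrals and Fatou's lemma\<close>

text \<open>
  The upper integral of \<open>\<bar>a\<bar>\<close> is at most \<open>c\<close>.  A Borel majorant replaces the integral of \<open>\<bar>a\<bar>\<close> because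
  the functions \<open>a\<close> below are restricted to the set of points where a limit exists, which need not
  be measurable.
\<close>

definition upper_L1 :: "(real \<Rightarrow> real) \<Rightarrow> ennreal \<Rightarrow> bool" where
  "upper_L1 a c \<longleftrightarrow> (\<exists>E \<in> borel_measurable lborel.
     (AE x in lborel. ennreal \<bar>a x\<bar> \<le> E x) \<and> (\<integral>\<^sup>+ x. E x \<partial>lborel) \<le> c)"

text \<open>
  Each of the three successive limits (vanishing noise, vanishing smoothing, shrinking neighbourhood
  of the jump) is taken with this form of Fatou's lemma.  The alternative \<open>b x = 0\<close> discards the points at
  which convergence is unknown.
\<close>

lemma upper_L1_Fatou:
  assumes bound: "\<forall>\<^sub>F n in sequentially. upper_L1 (a n) (c n)"
    and lim: "AE x in lborel. b x = 0 \<or> (\<lambda>n. a n x) \<longlonglongrightarrow> b x"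
    and c: "c \<longlonglongrightarrow> C"
  shows "upper_L1 b C"
proof -
  have "\<forall>n. \<exists>E \<in> borel_measurable lborel. upper_L1 (a n) (c n) \<longrightarrow>
      (AE x in lborel. ennreal \<bar>a n x\<bar> \<le> E x) \<and> (\<integral>\<^sup>+ x. E x \<partial>lborel) \<le> c n"
    unfolding upper_L1_def by (metis borel_measurable_const)
  then obtain E where E [measurable]: "\<And>n. E n \<in> borel_measurable lborel"
    and E': "\<And>n. upper_L1 (a n) (c n) \<Longrightarrow>
      (AE x in lborel. ennreal \<bar>a n x\<bar> \<le> E n x) \<and> (\<integral>\<^sup>+ x. E n x \<partial>lborel) \<le> c n"
    by metis
  have "AE x in lborel. \<forall>n. upper_L1 (a n) (c n) \<longrightarrow> ennreal \<bar>a n x\<bar> \<le> E n x"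
    using E' by (subst AE_all_countable) auto
  with lim have "AE x in lborel. ennreal \<bar>b x\<bar> \<le> liminf (\<lambda>n. E n x)"
  proof eventually_elim
    case (elim x)
    show ?case
    proof (cases "b x = 0")
      case False
      with elim have "(\<lambda>n. ennreal \<bar>a n x\<bar>) \<longlonglongrightarrow> ennreal \<bar>b x\<bar>"
        by (intro tendsto_ennrealI tendsto_rabs) auto
      then have "ennreal \<bar>b x\<bar> = liminf (\<lambda>n. ennreal \<bar>a n x\<bar>)"
        by (intro lim_imp_Liminf[symmetric]) auto
      also have "\<dots> \<le> liminf (\<lambda>n. E n x)"
        using bound elim by (intro Liminf_mono) (auto elim: eventually_mono)
      finally show ?thesis .
    qed simp
  qed
  moreover have "(\<integral>\<^sup>+ x. liminf (\<lambda>n. E n x) \<partial>lborel) \<le> C"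
  proof -
    have "(\<integral>\<^sup>+ x. liminf (\<lambda>n. E n x) \<partial>lborel) \<le> liminf (\<lambda>n. \<integral>\<^sup>+ x. E n x \<partial>lborel)"
      by (rule nn_integral_liminf) simp
    also have "\<dots> \<le> liminf c"
      using bound E' by (intro Liminf_mono) (auto elim: eventually_mono)
    also have "\<dots> = C"
      using c by (simp add: lim_imp_Liminf)
    finally show ?thesis .
  qed
  ultimately show ?thesis
    unfolding upper_L1_def by (intro bexI[of _ "\<lambda>x. liminf (\<lambda>n. E n x)"]) auto
qed

lemma upper_L1_zero:
  assumes "upper_L1 b 0" shows "AE x in lborel. b x = 0"
proof -
  obtain E where E [measurable]: "E \<in> borel_measurable lborel"
    and le: "AE x in lborel. ennreal \<bar>b x\<bar> \<le> E x" and "(\<integral>\<^sup>+ x. E x \<partial>lborel) \<le> 0"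
    using assms unfolding upper_L1_def by auto
  then have "AE x in lborel. E x = 0"
    by (subst nn_integral_0_iff_AE[symmetric]) auto
  with le show ?thesis by eventually_elim (simp add: ennreal_eq_0_iff)
qed

lemma upper_L1_mono:
  assumes "upper_L1 b c" "c \<le> d" shows "upper_L1 b d"
  using assms unfolding upper_L1_def by (meson order_trans)

section \<open>Gaussian smearing of a transported weight\<close>

lemma inverse_Suc_tendsto_at_right_0: "filterlim (\<lambda>n. 1 / real (Suc n)) (at_right 0) sequentially"
  unfolding filterlim_at using LIMSEQ_Suc[OF lim_1_over_n] by auto

lemma normal_density_commute: "normal_density x \<tau> y = normal_density y \<tau> x"
  by (simp add: normal_density_def power2_commute)

lemma normal_density_measurable2 [measurable]:
  assumes [measurable]: "f \<in> borel_measurable M" "g \<in> borel_measurable M"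
  shows "(\<lambda>z. normal_density (f z) \<tau> (g z)) \<in> borel_measurable M"
  unfolding normal_density_def by measurable

lemma nn_integral_normal_density:
  assumes "0 < \<tau>" shows "(\<integral>\<^sup>+ x. ennreal (normal_density y \<tau> x) \<partial>lborel) = 1"
  using assms by (subst nn_integral_eq_integral) auto

text \<open>
  The integral over \<open>s\<close> is the density of the image of the measure \<open>g ds\<close> under \<open>X\<close>, smeared by a
  Gaussian; this preserves the mass whatever the folds of \<open>X\<close>.  It is the source of every \<open>L\<^sup>1\<close> bound
  below.
\<close>

lemma nn_integral_smeared:
  assumes [measurable]: "g \<in> borel_measurable lborel" "X \<in> borel_measurable lborel" and "0 < \<tau>"
  shows "(\<integral>\<^sup>+ x. \<integral>\<^sup>+ s. g s * ennreal (normal_density x \<tau> (X s)) \<partial>lborel \<partial>lborel)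
    = (\<integral>\<^sup>+ s. g s \<partial>lborel)"
proof -
  have "(\<integral>\<^sup>+ x. \<integral>\<^sup>+ s. g s * ennreal (normal_density x \<tau> (X s)) \<partial>lborel \<partial>lborel)
      = (\<integral>\<^sup>+ s. \<integral>\<^sup>+ x. g s * ennreal (normal_density x \<tau> (X s)) \<partial>lborel \<partial>lborel)"
    by (rule lborel_pair.Fubini') measurable
  also have "\<dots> = (\<integral>\<^sup>+ s. g s * (\<integral>\<^sup>+ x. ennreal (normal_density (X s) \<tau> x) \<partial>lborel) \<partial>lborel)"
    by (simp add: nn_integral_cmult normal_density_commute)
  finally show ?thesis using \<open>0 < \<tau>\<close> by (simp add: nn_integral_normal_density)
qed

text \<open>
  As \<open>\<tau>\<close> tends to 0 the normal distribution concentrates at \<open>x\<close>; in the variable \<open>z = (y - x) / \<tau>\<close>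
  the integrand converges pointwise under a fixed dominating function.
\<close>

lemma normal_density_interval_tendsto:
  assumes c: "c < d" and x: "x \<noteq> c" "x \<noteq> d"
  shows "((\<lambda>\<tau>. LBINT y:{c..d}. normal_density x \<tau> y) \<longlongrightarrow> (indicator {c<..<d} x)) (at_right 0)"
proof -
  have eq: "(LBINT y:{c..d}. normal_density x \<tau> y) =
     (LBINT z. indicator {c..d} (x + \<tau> * z) * std_normal_density z)" if "0 < \<tau>" for \<tau>
  proof -
    have "(LBINT y:{c..d}. normal_density x \<tau> y) = \<tau> * (LBINT z. indicator {c..d} (x + \<tau> * z) * normal_density x \<tau> (x + \<tau> * z))"
      unfolding set_lebesgue_integral_def
      using that by (subst lborel_integral_real_affine[of \<tau> _ x]) auto
    also have "\<dots> = (LBINT z. indicator {c..d} (x + \<tau> * z) * (\<tau> * normal_density x \<tau> (x + \<tau> * z)))"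
      by (subst integral_mult_right_zero[symmetric]) (simp add: ac_simps)
    also have "(\<lambda>z. \<tau> * normal_density x \<tau> (x + \<tau> * z)) = std_normal_density"
      using that by (auto simp: normal_density_def power_mult_distrib real_sqrt_mult)
    finally show ?thesis .
  qed
  have "((\<lambda>\<tau>. LBINT z. indicator {c..d} (x + \<tau> * z) * std_normal_density z) \<longlongrightarrow>
      (LBINT z. indicator {c<..<d} x * std_normal_density z)) (at_right 0)"
  proof (rule tendsto_at_right_sequentially[of 0 1])
    fix S :: "nat \<Rightarrow> real" assume S: "S \<longlonglongrightarrow> 0"
    show "(\<lambda>n. LBINT z. indicator {c..d} (x + S n * z) * std_normal_density z) \<longlonglongrightarrow>
      (LBINT z. indicator {c<..<d} x * std_normal_density z)"
    proof (rule integral_dominated_convergence[where w = std_normal_density])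
      show "AE z in lborel. (\<lambda>n. indicator {c..d} (x + S n * z) * std_normal_density z)
          \<longlonglongrightarrow> indicator {c<..<d} x * std_normal_density z"
      proof (rule AE_I2)
        fix z
        have "(\<lambda>n. x + S n * z) \<longlonglongrightarrow> x + 0 * z" by (intro tendsto_intros S)
        then have T: "(\<lambda>n. x + S n * z) \<longlonglongrightarrow> x" by simp
        have "\<forall>\<^sub>F n in sequentially. x + S n * z \<in> {c..d} \<longleftrightarrow> x \<in> {c<..<d}"
        proof (cases "x < c \<or> d < x")
          case True
          then show ?thesis
          proof
            assume "x < c" from order_tendstoD(2)[OF T this] \<open>x < c\<close> show ?thesis by (auto elim!: eventually_mono)
          next
            assume "d < x" from order_tendstoD(1)[OF T this] \<open>d < x\<close> show ?thesis by (auto elim!: eventually_mono)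
          qed
        next
          case False
          with x have "c < x" "x < d" by auto
          from order_tendstoD(1)[OF T this(1)] order_tendstoD(2)[OF T this(2)] show ?thesis
            by eventually_elim (use \<open>c < x\<close> \<open>x < d\<close> in auto)
        qed
        then have "\<forall>\<^sub>F n in sequentially. indicator {c..d} (x + S n * z) * std_normal_density z = indicator {c<..<d} x * std_normal_density z"
          by eventually_elim (auto simp: indicator_def)
        then show "(\<lambda>n. indicator {c..d} (x + S n * z) * std_normal_density z)
          \<longlonglongrightarrow> indicator {c<..<d} x * std_normal_density z" by (rule tendsto_eventually)
      qed
    qed (auto simp: indicator_def)
  qed simp
  moreover have "(LBINT z. indicator {c<..<d} x * std_normal_density z) = indicator {c<..<d} x" by simp
  ultimately have "((\<lambda>\<tau>. LBINT z. indicator {c..d} (x + \<tau> * z) * std_normal_density z) \<longlongrightarrow>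
      indicator {c<..<d} x) (at_right 0)" by simp
  then show ?thesis
    by (rule Lim_transform_eventually)
       (auto simp: eq eventually_at_filter intro!: eventually_mono[OF eventually_at_right_less[of 0]])
qed

text \<open>
  A particle that starts at distance \<open>\<bar>s\<bar>\<close> from the origin and drifts by at most \<open>M\<close> stays at distance
  \<open>\<bar>s\<bar> / 2\<close> from \<open>x\<close>, so far particles are controlled by one centred Gaussian of twice the width.
\<close>

lemma normal_density_drift_tail:
  assumes \<tau>: "0 < \<tau>" and X: "\<bar>X s - s\<bar> \<le> M" and s: "2 * (\<bar>x\<bar> + M) \<le> \<bar>s\<bar>"
  shows "normal_density x \<tau> (X s) \<le> 2 * normal_density 0 (2 * \<tau>) s"
proof -
  have "\<bar>s\<bar> / 2 \<le> \<bar>X s - x\<bar>" using X s by (auto simp: abs_if split: if_splits)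
  then have "(\<bar>s\<bar> / 2)\<^sup>2 \<le> \<bar>X s - x\<bar>\<^sup>2" by (rule power_mono) simp
  then have "s\<^sup>2 / 4 \<le> (X s - x)\<^sup>2" by (simp add: power_divide)
  then have "s\<^sup>2 / 4 / (2 * \<tau>\<^sup>2) \<le> (X s - x)\<^sup>2 / (2 * \<tau>\<^sup>2)"
    by (rule divide_right_mono) simp
  then have "exp (- (X s - x)\<^sup>2 / (2 * \<tau>\<^sup>2)) \<le> exp (- s\<^sup>2 / (2 * (2 * \<tau>)\<^sup>2))"
    by (simp add: power_mult_distrib)
  moreover have "sqrt (2 * pi * (2 * \<tau>)\<^sup>2) = 2 * sqrt (2 * pi * \<tau>\<^sup>2)"
    by (subst real_sqrt_four[symmetric], subst real_sqrt_mult[symmetric]) (simp add: power_mult_distrib)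
  ultimately show ?thesis
    unfolding normal_density_def using \<tau> by (simp add: divide_right_mono)
qed

lemma integrable_smeared:
  assumes [measurable]: "W \<in> borel_measurable lborel" "X \<in> borel_measurable lborel"
    and \<tau>: "0 < \<tau>" and X: "\<And>s. \<bar>X s - s\<bar> \<le> M" and W: "\<And>s. \<bar>W s\<bar> \<le> N"
  shows "integrable lborel (\<lambda>s. W s * normal_density x \<tau> (X s))"
proof (rule Bochner_Integration.integrable_bound)
  let ?R = "2 * (\<bar>x\<bar> + M)"
  show "integrable lborel (\<lambda>s. N * (indicator {- ?R..?R} s * (1 / sqrt (2 * pi * \<tau>\<^sup>2)) + 2 * normal_density 0 (2 * \<tau>) s))"
    using \<tau> by (intro integrable_mult_right Bochner_Integration.integrable_add integrable_mult_left integrable_normal_density integrable_real_indicator) (auto simp: emeasure_lborel_Icc_eq)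
  show "AE s in lborel. norm (W s * normal_density x \<tau> (X s)) \<le> norm (N * (indicator {- ?R..?R} s * (1 / sqrt (2 * pi * \<tau>\<^sup>2)) + 2 * normal_density 0 (2 * \<tau>) s))"
  proof (rule AE_I2)
    fix s
    have "normal_density x \<tau> (X s) \<le> indicator {- ?R..?R} s * (1 / sqrt (2 * pi * \<tau>\<^sup>2)) + 2 * normal_density 0 (2 * \<tau>) s"
    proof (cases "s \<in> {- ?R..?R}")
      case True
      have "normal_density x \<tau> (X s) \<le> 1 / sqrt (2 * pi * \<tau>\<^sup>2) * 1"
        unfolding normal_density_def using \<tau> by (intro mult_left_mono) auto
      then show ?thesis using True by (simp add: add_increasing2)
    next
      case False
      then have "?R \<le> \<bar>s\<bar>" by auto
      from normal_density_drift_tail[where X = X, OF \<tau> X this] False show ?thesis by simp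
    qed
    then have "\<bar>W s\<bar> * normal_density x \<tau> (X s) \<le> N * (indicator {- ?R..?R} s * (1 / sqrt (2 * pi * \<tau>\<^sup>2)) + 2 * normal_density 0 (2 * \<tau>) s)"
      using W[of s] by (intro mult_mono) auto
    moreover have "0 \<le> N" using W[of s] by linarith
    ultimately show "norm (W s * normal_density x \<tau> (X s)) \<le> norm (N * (indicator {- ?R..?R} s * (1 / sqrt (2 * pi * \<tau>\<^sup>2)) + 2 * normal_density 0 (2 * \<tau>) s))"
      by (simp add: abs_mult)
  qed
qed simp

lemma smeared_tail_tendsto_0:
  assumes [measurable]: "W \<in> borel_measurable lborel" "X \<in> borel_measurable lborel"
    and X: "\<And>s. \<bar>X s - s\<bar> \<le> M" and W: "\<And>s. \<bar>W s\<bar> \<le> N"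
    and R: "0 < R" "2 * (\<bar>x\<bar> + M) \<le> R" "a \<le> - R" "R \<le> b"
  shows "((\<lambda>\<tau>. LBINT s. indicator (- {a..b}) s * W s * normal_density x \<tau> (X s)) \<longlongrightarrow> 0) (at_right 0)"
proof (rule Lim_null_comparison)
  have "((\<lambda>\<tau>. LBINT y:{-R..R}. normal_density 0 (2 * \<tau>) y) \<longlongrightarrow> indicator {-R<..<R} (0::real)) (at_right 0)"
    using R by (intro filterlim_compose[OF normal_density_interval_tendsto])
       (auto simp: filterlim_at eventually_at_filter intro!: tendsto_eq_intros)
  then have "((\<lambda>\<tau>. 2 * N * (1 - (LBINT y:{-R..R}. normal_density 0 (2 * \<tau>) y))) \<longlongrightarrow> 2 * N * (1 - indicator {-R<..<R} (0::real))) (at_right 0)"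
    by (intro tendsto_intros)
  then show "((\<lambda>\<tau>. 2 * N * (1 - (LBINT y:{-R..R}. normal_density 0 (2 * \<tau>) y))) \<longlongrightarrow> 0) (at_right 0)"
    using R by simp
  show "\<forall>\<^sub>F \<tau> in at_right 0. norm (LBINT s. indicator (- {a..b}) s * W s * normal_density x \<tau> (X s))
      \<le> 2 * N * (1 - (LBINT y:{-R..R}. normal_density 0 (2 * \<tau>) y))"
    using eventually_at_right_less[of 0]
  proof eventually_elim
    case (elim \<tau>)
    have int: "integrable lborel (\<lambda>y. indicator {-R..R} y * normal_density 0 (2 * \<tau>) y)"
      using elim integrable_real_mult_indicator[of "{-R..R}" lborel "normal_density 0 (2 * \<tau>)"]
      by (simp add: mult.commute)
    have "norm (LBINT s. indicator (- {a..b}) s * W s * normal_density x \<tau> (X s))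
      \<le> (LBINT s. 2 * N * (normal_density 0 (2 * \<tau>) s - indicator {-R..R} s * normal_density 0 (2 * \<tau>) s))"
    proof (rule Bochner_Integration.integral_norm_bound_integral)
      show "integrable lborel (\<lambda>s. indicator (- {a..b}) s * W s * normal_density x \<tau> (X s))"
        by (rule integrable_smeared[where M = M and N = N]) (use elim X W in \<open>auto simp: indicator_def intro: order_trans[OF abs_ge_zero]\<close>)
      show "integrable lborel (\<lambda>s. 2 * N * (normal_density 0 (2 * \<tau>) s - indicator {-R..R} s * normal_density 0 (2 * \<tau>) s))"
        using elim int by (intro integrable_mult_right Bochner_Integration.integrable_diff) auto
      fix s
      show "norm (indicator (- {a..b}) s * W s * normal_density x \<tau> (X s))
          \<le> 2 * N * (normal_density 0 (2 * \<tau>) s - indicator {-R..R} s * normal_density 0 (2 * \<tau>) s)"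
      proof (cases "s \<in> {a..b}")
        case True
        then show ?thesis using W[of s] by (auto simp: indicator_def)
      next
        case False
        then have "s \<notin> {-R..R}" using R by auto
        then have "2 * (\<bar>x\<bar> + M) \<le> \<bar>s\<bar>" using R by auto
        from normal_density_drift_tail[where X = X, OF elim X this]
        have "\<bar>W s\<bar> * normal_density x \<tau> (X s) \<le> N * (2 * normal_density 0 (2 * \<tau>) s)"
          using W[of s] by (intro mult_mono) auto
        then show ?thesis using False \<open>s \<notin> {-R..R}\<close> by (simp add: abs_mult)
      qed
    qed
    also have "\<dots> = 2 * N * (1 - (LBINT y:{-R..R}. normal_density 0 (2 * \<tau>) y))"
      unfolding set_lebesgue_integral_def using elim int
      by (simp add: Bochner_Integration.integral_diff)
    finally show ?case .
  qed
qed

text \<open>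
  With the factor \<open>X'\<close> the smeared density of a block of particles is an exact integral in the image
  variable, also where \<open>X\<close> is not monotone: the signed contributions of a fold cancel.
\<close>

lemma smeared_block:
  fixes X X' :: "real \<Rightarrow> real"
  assumes X': "\<And>s. (X has_real_derivative X' s) (at s)" "continuous_on UNIV X'"
    and ab: "a < b" "X a < X b" and \<tau>: "0 < \<tau>"
  shows "(LBINT s:{a..b}. X' s * normal_density x \<tau> (X s)) = (LBINT y:{X a..X b}. normal_density x \<tau> y)"
proof -
  have "(LBINT s=a..b. X' s *\<^sub>R normal_density x \<tau> (X s)) = (LBINT y=X a..X b. normal_density x \<tau> y)"
  proof (rule interval_integral_substitution_finite)
    show "continuous_on (X ` {a..b}) (normal_density x \<tau>)"
      unfolding normal_density_def using \<tau> by (intro continuous_intros) auto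
    show "continuous_on {a..b} X'" using X'(2) by (rule continuous_on_subset) simp
  qed (use ab X'(1) in \<open>auto intro: has_field_derivative_at_within\<close>)
  then show ?thesis using ab by (simp add: interval_integral_Icc)
qed

text \<open>
  Compare \<open>W\<close> with \<open>w\<^sub>1 X'\<close> on \<open>[a, l]\<close> and with \<open>w\<^sub>2 X'\<close> on \<open>[r, b]\<close>.  By the preceding substitution the
  smeared densities of these comparison weights converge to step functions; particles outside \<open>[a, b]\<close> do
  not reach \<open>\<bar>x\<bar> \<le> \<rho>\<close>; and the smeared difference of the weights has \<open>L\<^sup>1\<close> norm at most the mass of that
  difference.  So the limit \<open>H\<close> is close to a step function in \<open>L\<^sup>1\<close>.
\<close>

lemma smeared_limit_bound:
  fixes W X X' H :: "real \<Rightarrow> real"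
  assumes X': "\<And>s. (X has_real_derivative X' s) (at s)" "continuous_on UNIV X'"
    and W [measurable]: "W \<in> borel_measurable lborel"
    and X: "\<And>s. \<bar>X s - s\<bar> \<le> M" and N: "\<And>s. \<bar>W s\<bar> \<le> N"
    and lr: "a < l" "l < r" "r < b" "X a < X l" "X r < X b"
    and \<rho>: "0 < \<rho>" "a \<le> - 2 * (\<rho> + M)" "2 * (\<rho> + M) \<le> b"
    and H: "\<And>x. x \<in> S \<Longrightarrow> ((\<lambda>\<tau>. LBINT s. W s * normal_density x \<tau> (X s)) \<longlongrightarrow> H x) (at_right 0)"
  shows "upper_L1
    (\<lambda>x. if x \<in> S \<and> \<bar>x\<bar> \<le> \<rho> then H x - w\<^sub>1 * indicator {X a<..<X l} x - w\<^sub>2 * indicator {X r<..<X b} x else 0)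
    (\<integral>\<^sup>+ s. ennreal (indicator {a..b} s * \<bar>W s - (w\<^sub>1 * indicator {a..l} s + w\<^sub>2 * indicator {r..b} s) * X' s\<bar>) \<partial>lborel)"
proof -
  define D where "D s = indicator {a..b} s * (W s - (w\<^sub>1 * indicator {a..l} s + w\<^sub>2 * indicator {r..b} s) * X' s)" for s
  have contX: "continuous_on UNIV X" using X'(1) by (meson DERIV_continuous_on has_field_derivative_at_within)
  have [measurable]: "X \<in> borel_measurable borel" "X' \<in> borel_measurable borel"
    using contX X'(2) by (auto intro: borel_measurable_continuous_onI)
  have [measurable]: "W \<in> borel_measurable borel" using W by simp
  have D [measurable]: "D \<in> borel_measurable borel" unfolding D_def by measurable
  have M: "0 \<le> M" using X[of 0] by linarith
  define T :: "nat \<Rightarrow> real" where "T n = 1 / real (Suc n)" for n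
  have T0: "0 < T n" for n by (simp add: T_def)
  have T: "filterlim T (at_right 0) sequentially"
    unfolding T_def by (rule inverse_Suc_tendsto_at_right_0)
  have "upper_L1
    (\<lambda>x. if x \<in> S \<and> \<bar>x\<bar> \<le> \<rho> then H x - w\<^sub>1 * indicator {X a<..<X l} x - w\<^sub>2 * indicator {X r<..<X b} x else 0)
    (\<integral>\<^sup>+ s. ennreal \<bar>D s\<bar> \<partial>lborel)"
  proof (rule upper_L1_Fatou)
    define A where "A n x = (LBINT s. D s * normal_density x (T n) (X s))" for n x
    show "\<forall>\<^sub>F n in sequentially. upper_L1 (A n) (\<integral>\<^sup>+ s. ennreal \<bar>D s\<bar> \<partial>lborel)"
    proof (rule always_eventually, rule allI)
      fix n
      let ?E = "\<lambda>x. \<integral>\<^sup>+ s. ennreal \<bar>D s\<bar> * ennreal (normal_density x (T n) (X s)) \<partial>lborel"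
      have "ennreal \<bar>A n x\<bar> \<le> ?E x" for x
      proof (cases "integrable lborel (\<lambda>s. D s * normal_density x (T n) (X s))")
        case True
        then have "ennreal (norm (A n x)) \<le> (\<integral>\<^sup>+ s. ennreal (norm (D s * normal_density x (T n) (X s))) \<partial>lborel)"
          unfolding A_def by (rule integral_norm_bound_ennreal)
        then show ?thesis by (simp add: abs_mult ennreal_mult)
      qed (simp add: A_def not_integrable_integral_eq)
      moreover have "(\<integral>\<^sup>+ x. ?E x \<partial>lborel) = (\<integral>\<^sup>+ s. ennreal \<bar>D s\<bar> \<partial>lborel)"
        using T0 by (intro nn_integral_smeared) auto
      moreover have "?E \<in> borel_measurable lborel" by measurable
      ultimately show "upper_L1 (A n) (\<integral>\<^sup>+ s. ennreal \<bar>D s\<bar> \<partial>lborel)"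
        unfolding upper_L1_def by (intro bexI[of _ ?E]) auto
    qed
    have split: "A n x = (LBINT s. W s * normal_density x (T n) (X s))
        - (LBINT s. indicator (- {a..b}) s * W s * normal_density x (T n) (X s))
        - w\<^sub>1 * (LBINT y:{X a..X l}. normal_density x (T n) y) - w\<^sub>2 * (LBINT y:{X r..X b}. normal_density x (T n) y)" for n x
    proof -
      have block: "integrable lborel (\<lambda>s. indicator {c..d} s * (X' s * normal_density x (T n) (X s)))" for c d
      proof -
        have "continuous_on {c..d} (\<lambda>s. X' s * normal_density x (T n) (X s))"
          unfolding normal_density_def using T0[of n] contX X'(2)
          by (intro continuous_intros) (auto elim: continuous_on_subset)
        from borel_integrable_atLeastAtMost'[OF this] show ?thesis
          unfolding set_integrable_def by simp
      qed
      have 1: "integrable lborel (\<lambda>s. W s * normal_density x (T n) (X s))"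
        using X N T0 by (intro integrable_smeared) auto
      have 2: "integrable lborel (\<lambda>s. indicator (- {a..b}) s * W s * normal_density x (T n) (X s))"
        by (rule integrable_smeared[where M = M and N = N])
           (use T0 X N in \<open>auto simp: indicator_def intro: order_trans[OF abs_ge_zero]\<close>)
      have "A n x = (LBINT s. W s * normal_density x (T n) (X s)
          - indicator (- {a..b}) s * W s * normal_density x (T n) (X s)
          - w\<^sub>1 * (indicator {a..l} s * (X' s * normal_density x (T n) (X s)))
          - w\<^sub>2 * (indicator {r..b} s * (X' s * normal_density x (T n) (X s))))"
        unfolding A_def D_def using lr
        by (intro Bochner_Integration.integral_cong) (auto simp: indicator_def algebra_simps)
      also have "\<dots> = (LBINT s. W s * normal_density x (T n) (X s))
        - (LBINT s. indicator (- {a..b}) s * W s * normal_density x (T n) (X s))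
        - w\<^sub>1 * (LBINT s:{a..l}. X' s * normal_density x (T n) (X s)) - w\<^sub>2 * (LBINT s:{r..b}. X' s * normal_density x (T n) (X s))"
        using 1 2 block unfolding set_lebesgue_integral_def
        by (simp add: Bochner_Integration.integral_diff Bochner_Integration.integrable_diff)
      finally show ?thesis
        using smeared_block[OF X' lr(1,4) T0] smeared_block[OF X' lr(3,5) T0] by simp
    qed
    have "AE x in lborel. x \<notin> {X a, X l, X r, X b}"
      by (intro AE_not_in finite_imp_null_set_lborel) simp
    then show "AE x in lborel. (if x \<in> S \<and> \<bar>x\<bar> \<le> \<rho> then H x - w\<^sub>1 * indicator {X a<..<X l} x - w\<^sub>2 * indicator {X r<..<X b} x else 0) = 0 \<or>
        (\<lambda>n. A n x) \<longlonglongrightarrow> (if x \<in> S \<and> \<bar>x\<bar> \<le> \<rho> then H x - w\<^sub>1 * indicator {X a<..<X l} x - w\<^sub>2 * indicator {X r<..<X b} x else 0)"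
    proof eventually_elim
      case (elim x)
      show ?case
      proof (cases "x \<in> S \<and> \<bar>x\<bar> \<le> \<rho>")
        case True
        have tail: "((\<lambda>\<tau>. LBINT s. indicator (- {a..b}) s * W s * normal_density x \<tau> (X s)) \<longlongrightarrow> 0) (at_right 0)"
          using True \<rho> X N M by (intro smeared_tail_tendsto_0[where M = M and N = N and R = "2 * (\<rho> + M)"]) auto
        have "(\<lambda>n. A n x) \<longlonglongrightarrow> H x - 0 - w\<^sub>1 * indicator {X a<..<X l} x - w\<^sub>2 * indicator {X r<..<X b} x"
          unfolding split using True elim lr
          by (intro tendsto_diff tendsto_mult tendsto_const filterlim_compose[OF H T] filterlim_compose[OF tail T]
              filterlim_compose[OF normal_density_interval_tendsto T]) auto
        then show ?thesis using True by simp
      qed auto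
    qed
  qed simp
  then show ?thesis by (simp add: D_def abs_mult)
qed

text \<open>
  The factor \<open>1 / (sqrt (2 \<pi> t) \<sigma>)\<close> makes the exponential the normal density of standard deviation
  \<open>\<sigma> sqrt t\<close>.
\<close>

lemma particle_density_eq_smeared:
  assumes "0 < \<sigma>" "0 < t"
  shows "particle_density W U \<sigma> t x = (LBINT s. W s * normal_density x (\<sigma> * sqrt t) (s + U s * t))"
proof -
  have "1 / (sqrt (2 * pi * t) * \<sigma>) * (W s * exp (- (\<bar>U s * t + s - x\<bar>\<^sup>2 / (2 * \<sigma>\<^sup>2 * t))))
      = W s * normal_density x (\<sigma> * sqrt t) (s + U s * t)" for s
    using assms by (simp add: normal_density_def power_mult_distrib real_sqrt_mult ac_simps)
  then show ?thesis
    unfolding particle_density_def by (subst integral_mult_right_zero[symmetric]) simp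
qed

lemma AE_lborel_exists_between:
  assumes "AE x in lborel. P x" "a < (b :: real)"
  shows "\<exists>x. a < x \<and> x < b \<and> P x"
proof (rule ccontr)
  assume "\<not> ?thesis"
  with assms(1) have "AE x in lborel. x \<notin> {a<..<b}" by (auto elim: eventually_mono)
  then have "emeasure lborel {a<..<b} = 0"
    by (subst (asm) AE_iff_measurable[of "{a<..<b}"]) auto
  with assms(2) show False by simp
qed

lemma tendsto_indicator_greaterThanLessThan:
  fixes x :: real
  assumes "(f \<longlongrightarrow> a) F" "(g \<longlongrightarrow> b) F" "x \<noteq> a" "x \<noteq> b"
  shows "((\<lambda>n. indicator {f n<..<g n} x :: real) \<longlongrightarrow> indicator {a<..<b} x) F"
proof (rule tendsto_eventually)
  have "\<forall>\<^sub>F n in F. f n < x \<longleftrightarrow> a < x"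
  proof (cases "a < x")
    case True
    with order_tendstoD(2)[OF assms(1) True] show ?thesis by simp
  next
    case False
    with assms(3) have "x < a" by simp
    from order_tendstoD(1)[OF assms(1) this] False show ?thesis by (auto elim!: eventually_mono)
  qed
  moreover have "\<forall>\<^sub>F n in F. x < g n \<longleftrightarrow> x < b"
  proof (cases "x < b")
    case True
    with order_tendstoD(1)[OF assms(2) True] show ?thesis by simp
  next
    case False
    with assms(4) have "b < x" by simp
    from order_tendstoD(2)[OF assms(2) this] False show ?thesis by (auto elim!: eventually_mono)
  qed
  ultimately show "\<forall>\<^sub>F n in F. indicator {f n<..<g n} x = (indicator {a<..<b} x :: real)"
    by eventually_elim (simp add: indicator_def)
qed

section \<open>The density of the particles for a smoothed jump\<close>

text \<open>
  A weight \<open>W\<close> of either sign carried by the particles with velocities \<open>U\<close>.  The weight will be the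
  smoothed density in one application and the smoothed momentum in the other.
\<close>

locale jump_smoothing =
  fixes W U :: "real \<Rightarrow> real \<Rightarrow> real" and w\<^sub>1 w\<^sub>2 c\<^sub>1 c\<^sub>2 M N :: real
  assumes W_cont: "\<And>\<epsilon>. 0 < \<epsilon> \<Longrightarrow> continuous_on UNIV (W \<epsilon>)"
    and W_bound: "\<And>\<epsilon> s. 0 < \<epsilon> \<Longrightarrow> \<bar>W \<epsilon> s\<bar> \<le> N"
    and W_lim: "AE s in lborel. ((\<lambda>\<epsilon>. W \<epsilon> s) \<longlongrightarrow> (if s < 0 then w\<^sub>1 else w\<^sub>2)) (at_right 0)"
    and U_C1: "\<And>\<epsilon>. 0 < \<epsilon> \<Longrightarrow> U \<epsilon> C1_differentiable_on UNIV"
    and U_bound: "\<And>\<epsilon> s. 0 < \<epsilon> \<Longrightarrow> \<bar>U \<epsilon> s\<bar> \<le> M"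
    and U_lim: "AE s in lborel. ((\<lambda>\<epsilon>. U \<epsilon> s) \<longlongrightarrow> (if s < 0 then c\<^sub>1 else c\<^sub>2)) (at_right 0)"
    and U_var: "\<And>a b. a < b \<Longrightarrow> 0 \<notin> {a..b} \<Longrightarrow>
      ((\<lambda>\<epsilon>. LBINT s:{a..b}. \<bar>deriv (U \<epsilon>) s\<bar>) \<longlongrightarrow> 0) (at_right 0)"
begin

lemma N_nonneg: "0 \<le> N"
  using W_bound[of 1 0] by simp

lemma M_nonneg: "0 \<le> M"
  using U_bound[of 1 0] by simp

lemma U_deriv:
  assumes "0 < \<epsilon>"
  shows "(U \<epsilon> has_real_derivative deriv (U \<epsilon>) s) (at s)" "continuous_on UNIV (deriv (U \<epsilon>))"
proof -
  from U_C1[OF assms] obtain D where D: "\<And>x. (U \<epsilon> has_vector_derivative D x) (at x)" "continuous_on UNIV D"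
    unfolding C1_differentiable_on_def by auto
  then have "(U \<epsilon> has_real_derivative D x) (at x)" for x
    by (simp add: has_real_derivative_iff_has_vector_derivative)
  moreover from this have "deriv (U \<epsilon>) = D" by (auto intro: DERIV_imp_deriv)
  ultimately show "(U \<epsilon> has_real_derivative deriv (U \<epsilon>) s) (at s)" "continuous_on UNIV (deriv (U \<epsilon>))"
    using D by auto
qed

lemma block_tendsto_0:
  assumes "a < b" "0 \<notin> {a..b}" and w: "w = (if b < 0 then w\<^sub>1 else w\<^sub>2)"
  shows "((\<lambda>\<epsilon>. LBINT s:{a..b}. \<bar>W \<epsilon> s - w\<bar>) \<longlongrightarrow> 0) (at_right 0)"
proof (rule tendsto_at_right_sequentially[of 0 1])
  fix S :: "nat \<Rightarrow> real" assume S: "\<And>n. 0 < S n" "\<And>n. S n < 1" "decseq S" "S \<longlonglongrightarrow> 0"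
  then have S': "filterlim S (at_right 0) sequentially" by (auto simp: filterlim_at intro!: always_eventually less_imp_neq[symmetric])
  have "(\<lambda>n. LBINT s. indicator {a..b} s *\<^sub>R \<bar>W (S n) s - w\<bar>) \<longlonglongrightarrow> (LBINT s::real. 0)"
  proof (rule integral_dominated_convergence[where w = "\<lambda>s. indicator {a..b} s * (N + \<bar>w\<bar>)"])
    have [measurable]: "W (S n) \<in> borel_measurable borel" for n
      using W_cont[OF S(1)] by (rule borel_measurable_continuous_onI)
    show "(\<lambda>s. indicator {a..b} s *\<^sub>R \<bar>W (S n) s - w\<bar>) \<in> borel_measurable lborel" for n
      by measurable
    show "integrable lborel (\<lambda>s. indicator {a..b} s * (N + \<bar>w\<bar>))"
      by (intro integrable_mult_left integrable_real_indicator) (auto simp: emeasure_lborel_Icc_eq)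
    have "\<bar>W (S n) s - w\<bar> \<le> N + \<bar>w\<bar>" for n s
      using W_bound[OF S(1), of n s] by linarith
    then show "AE s in lborel. norm (indicator {a..b} s *\<^sub>R \<bar>W (S n) s - w\<bar>) \<le> indicator {a..b} s * (N + \<bar>w\<bar>)" for n
      by (auto simp: indicator_def)
    show "AE s in lborel. (\<lambda>n. indicator {a..b} s *\<^sub>R \<bar>W (S n) s - w\<bar>) \<longlonglongrightarrow> 0"
      using W_lim
    proof eventually_elim
      case (elim s)
      show ?case
      proof (cases "s \<in> {a..b}")
        case True
        then have "(if s < 0 then w\<^sub>1 else w\<^sub>2) = w" using assms by (auto split: if_splits)
        then have "(\<lambda>n. W (S n) s - w) \<longlonglongrightarrow> w - w"
          using filterlim_compose[OF elim S'] by (intro tendsto_diff) auto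
        then have "(\<lambda>n. \<bar>W (S n) s - w\<bar>) \<longlonglongrightarrow> 0" by (simp add: tendsto_rabs_zero)
        then show ?thesis using True by simp
      qed simp
    qed
  qed simp
  then show "(\<lambda>n. LBINT s:{a..b}. \<bar>W (S n) s - w\<bar>) \<longlonglongrightarrow> 0"
    by (simp add: set_lebesgue_integral_def)
qed simp

text \<open>
  The limit of vanishing smoothing for fixed blocks \<open>[a, l]\<close> and \<open>[r, b]\<close> on the two sides of the jump.
  There \<open>W\<close> tends to a constant in \<open>L\<^sup>1\<close> by dominated convergence and \<open>X' = 1 + t U'\<close> tends to 1 in \<open>L\<^sup>1\<close>
  by the condition on the variation, so the comparison error in \<open>smeared_limit_bound\<close> vanishes on the
  blocks; only the mass of the particles between them remains, at most \<open>N (r - l)\<close>, wherever it has gone.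
\<close>

lemma density_near_step:
  assumes t: "0 < t"
    and lr: "a < l" "l < 0" "0 < r" "r < b"
    and good: "((\<lambda>\<epsilon>. U \<epsilon> a) \<longlongrightarrow> c\<^sub>1) (at_right 0)" "((\<lambda>\<epsilon>. U \<epsilon> l) \<longlongrightarrow> c\<^sub>1) (at_right 0)"
      "((\<lambda>\<epsilon>. U \<epsilon> r) \<longlongrightarrow> c\<^sub>2) (at_right 0)" "((\<lambda>\<epsilon>. U \<epsilon> b) \<longlongrightarrow> c\<^sub>2) (at_right 0)"
    and \<rho>: "0 < \<rho>" "a \<le> - 2 * (\<rho> + M * t)" "2 * (\<rho> + M * t) \<le> b"
    and h: "AE x in lborel. has_iterated_limit (\<lambda>\<epsilon> \<sigma>. particle_density (W \<epsilon>) (U \<epsilon>) \<sigma> t x) (h x)"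
  shows "upper_L1 (\<lambda>x. if \<bar>x\<bar> \<le> \<rho> then h x - w\<^sub>1 * indicator {a + c\<^sub>1 * t<..<l + c\<^sub>1 * t} x
      - w\<^sub>2 * indicator {r + c\<^sub>2 * t<..<b + c\<^sub>2 * t} x else 0) (ennreal (N * (r - l)))"
proof -
  define X where "X \<epsilon> s = s + U \<epsilon> s * t" for \<epsilon> s
  define X' where "X' \<epsilon> s = 1 + deriv (U \<epsilon>) s * t" for \<epsilon> s
  define v where "v s = w\<^sub>1 * indicator {a..l} s + w\<^sub>2 * indicator {r..b} s" for s :: real
  \<comment> \<open>Bound for the comparison error: the particles in \<open>[l, r]\<close> and the two blocks.\<close>
  define \<delta> where "\<delta> \<epsilon> = N * (r - l)
      + ((LBINT s:{a..l}. \<bar>W \<epsilon> s - w\<^sub>1\<bar>) + \<bar>w\<^sub>1\<bar> * t * (LBINT s:{a..l}. \<bar>deriv (U \<epsilon>) s\<bar>))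
      + ((LBINT s:{r..b}. \<bar>W \<epsilon> s - w\<^sub>2\<bar>) + \<bar>w\<^sub>2\<bar> * t * (LBINT s:{r..b}. \<bar>deriv (U \<epsilon>) s\<bar>))" for \<epsilon>
  have X_lim: "((\<lambda>\<epsilon>. X \<epsilon> a) \<longlongrightarrow> a + c\<^sub>1 * t) (at_right 0)" "((\<lambda>\<epsilon>. X \<epsilon> l) \<longlongrightarrow> l + c\<^sub>1 * t) (at_right 0)"
      "((\<lambda>\<epsilon>. X \<epsilon> r) \<longlongrightarrow> r + c\<^sub>2 * t) (at_right 0)" "((\<lambda>\<epsilon>. X \<epsilon> b) \<longlongrightarrow> b + c\<^sub>2 * t) (at_right 0)"
    unfolding X_def by (intro tendsto_intros good)+
  have \<delta>_lim: "(\<delta> \<longlongrightarrow> N * (r - l)) (at_right 0)"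
    unfolding \<delta>_def using lr
    by (auto intro!: tendsto_eq_intros block_tendsto_0 U_var)
  have error: "(\<integral>\<^sup>+ s. ennreal (indicator {a..b} s * \<bar>W \<epsilon> s - v s * X' \<epsilon> s\<bar>) \<partial>lborel) \<le> ennreal (\<delta> \<epsilon>)"
    if \<epsilon>: "0 < \<epsilon>" for \<epsilon>
  proof -
    define g where "g c d w s = indicator {c..d} s * \<bar>W \<epsilon> s - w\<bar> + \<bar>w\<bar> * t * (indicator {c..d} s * \<bar>deriv (U \<epsilon>) s\<bar>)" for c d w s
    have int: "integrable lborel (\<lambda>s. indicator {c..d} s * \<bar>W \<epsilon> s - w\<bar>)"
      "integrable lborel (\<lambda>s. indicator {c..d} s * \<bar>deriv (U \<epsilon>) s\<bar>)" for c d w :: real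
    proof -
      have "continuous_on {c..d} (\<lambda>s. \<bar>W \<epsilon> s - w\<bar>)" "continuous_on {c..d} (\<lambda>s. \<bar>deriv (U \<epsilon>) s\<bar>)"
        using W_cont[OF \<epsilon>] U_deriv(2)[OF \<epsilon>] by (auto intro!: continuous_intros elim: continuous_on_subset)
      from this[THEN borel_integrable_atLeastAtMost']
      show "integrable lborel (\<lambda>s. indicator {c..d} s * \<bar>W \<epsilon> s - w\<bar>)"
      "integrable lborel (\<lambda>s. indicator {c..d} s * \<bar>deriv (U \<epsilon>) s\<bar>)"
        by (simp_all add: set_integrable_def)
    qed
    have g: "integrable lborel (g c d w)"
      "integral\<^sup>L lborel (g c d w) = (LBINT s:{c..d}. \<bar>W \<epsilon> s - w\<bar>) + \<bar>w\<bar> * t * (LBINT s:{c..d}. \<bar>deriv (U \<epsilon>) s\<bar>)" for c d w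
      unfolding g_def using int by (auto simp: set_lebesgue_integral_def)
    have g_nonneg: "0 \<le> g c d w s" for c d w s
      using t by (simp add: g_def)
    have mid: "integrable lborel (\<lambda>s. N * indicator {l..r} s)" "(LBINT s. N * indicator {l..r} s) = N * (r - l)"
      using lr by (auto simp: emeasure_lborel_Icc_eq)
    have X'_bound: "\<bar>W \<epsilon> s - w * X' \<epsilon> s\<bar> \<le> \<bar>W \<epsilon> s - w\<bar> + \<bar>w\<bar> * t * \<bar>deriv (U \<epsilon>) s\<bar>" for w s
    proof -
      have "W \<epsilon> s - w * X' \<epsilon> s = (W \<epsilon> s - w) - w * t * deriv (U \<epsilon>) s" by (simp add: X'_def algebra_simps)
      then have "\<bar>W \<epsilon> s - w * X' \<epsilon> s\<bar> \<le> \<bar>W \<epsilon> s - w\<bar> + \<bar>w * t * deriv (U \<epsilon>) s\<bar>" by linarith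
      then show ?thesis using t by (simp add: abs_mult)
    qed
    have "indicator {a..b} s * \<bar>W \<epsilon> s - v s * X' \<epsilon> s\<bar> \<le> N * indicator {l..r} s + g a l w\<^sub>1 s + g r b w\<^sub>2 s" for s
    proof -
      consider "s \<notin> {a..b}" | "s \<in> {a..l}" | "s \<in> {r..b}" | "s \<in> {l<..<r}" by fastforce
      then show ?thesis
      proof cases
        case 1
        then show ?thesis using g_nonneg N_nonneg by (simp add: add_nonneg_nonneg)
      next
        case 2
        then have "v s = w\<^sub>1" "s \<in> {a..b}" "g a l w\<^sub>1 s = \<bar>W \<epsilon> s - w\<^sub>1\<bar> + \<bar>w\<^sub>1\<bar> * t * \<bar>deriv (U \<epsilon>) s\<bar>"
          using lr by (auto simp: v_def g_def)
        then show ?thesis using X'_bound[of s w\<^sub>1] g_nonneg[of r b w\<^sub>2 s] N_nonneg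
          by (simp add: indicator_def)
      next
        case 3
        then have "v s = w\<^sub>2" "s \<in> {a..b}" "g r b w\<^sub>2 s = \<bar>W \<epsilon> s - w\<^sub>2\<bar> + \<bar>w\<^sub>2\<bar> * t * \<bar>deriv (U \<epsilon>) s\<bar>"
          using lr by (auto simp: v_def g_def)
        then show ?thesis using X'_bound[of s w\<^sub>2] g_nonneg[of a l w\<^sub>1 s] N_nonneg
          by (simp add: indicator_def)
      next
        case 4
        then show ?thesis using W_bound[OF \<epsilon>, of s] g_nonneg[of r b w\<^sub>2 s] g_nonneg[of a l w\<^sub>1 s]
          by (simp add: v_def indicator_def)
      qed
    qed
    then have "(\<integral>\<^sup>+ s. ennreal (indicator {a..b} s * \<bar>W \<epsilon> s - v s * X' \<epsilon> s\<bar>) \<partial>lborel)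
        \<le> (\<integral>\<^sup>+ s. ennreal (N * indicator {l..r} s + g a l w\<^sub>1 s + g r b w\<^sub>2 s) \<partial>lborel)"
      by (intro nn_integral_mono ennreal_leI)
    also have "\<dots> = ennreal (LBINT s. N * indicator {l..r} s + g a l w\<^sub>1 s + g r b w\<^sub>2 s)"
      using mid g g_nonneg N_nonneg by (intro nn_integral_eq_integral) auto
    also have "(LBINT s. N * indicator {l..r} s + g a l w\<^sub>1 s + g r b w\<^sub>2 s) = \<delta> \<epsilon>"
      using mid g by (subst Bochner_Integration.integral_add Bochner_Integration.integrable_add; simp add: \<delta>_def)+
    finally show ?thesis .
  qed
  have "\<forall>x. \<exists>H. has_iterated_limit (\<lambda>\<epsilon> \<sigma>. particle_density (W \<epsilon>) (U \<epsilon>) \<sigma> t x) (h x) \<longrightarrow>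
      (\<forall>\<^sub>F \<epsilon> in at_right 0. ((\<lambda>\<sigma>. particle_density (W \<epsilon>) (U \<epsilon>) \<sigma> t x) \<longlongrightarrow> H \<epsilon>) (at_right 0)) \<and> (H \<longlongrightarrow> h x) (at_right 0)"
    unfolding has_iterated_limit_def by blast
  then have "\<exists>H. \<forall>x. has_iterated_limit (\<lambda>\<epsilon> \<sigma>. particle_density (W \<epsilon>) (U \<epsilon>) \<sigma> t x) (h x) \<longrightarrow>
      (\<forall>\<^sub>F \<epsilon> in at_right 0. ((\<lambda>\<sigma>. particle_density (W \<epsilon>) (U \<epsilon>) \<sigma> t x) \<longlongrightarrow> H x \<epsilon>) (at_right 0)) \<and> (H x \<longlongrightarrow> h x) (at_right 0)"
    by (rule choice)
  then obtain H where H: "\<forall>x. has_iterated_limit (\<lambda>\<epsilon> \<sigma>. particle_density (W \<epsilon>) (U \<epsilon>) \<sigma> t x) (h x) \<longrightarrow>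
      (\<forall>\<^sub>F \<epsilon> in at_right 0. ((\<lambda>\<sigma>. particle_density (W \<epsilon>) (U \<epsilon>) \<sigma> t x) \<longlongrightarrow> H x \<epsilon>) (at_right 0)) \<and> (H x \<longlongrightarrow> h x) (at_right 0)"
    ..
  \<comment> \<open>The inner limit exists for all small \<open>\<epsilon>\<close>, but how small depends on \<open>x\<close>; \<open>S \<epsilon>\<close> consists of the points at which it exists for \<open>\<epsilon>\<close>.\<close>
  define S where "S \<epsilon> = {x. ((\<lambda>\<sigma>. particle_density (W \<epsilon>) (U \<epsilon>) \<sigma> t x) \<longlongrightarrow> H x \<epsilon>) (at_right 0)}" for \<epsilon>
  define A where "A \<epsilon> x = (if x \<in> S \<epsilon> \<and> \<bar>x\<bar> \<le> \<rho> then H x \<epsilon> - w\<^sub>1 * indicator {X \<epsilon> a<..<X \<epsilon> l} x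
      - w\<^sub>2 * indicator {X \<epsilon> r<..<X \<epsilon> b} x else 0)" for \<epsilon> x
  have A: "upper_L1 (A \<epsilon>) (ennreal (\<delta> \<epsilon>))" if \<epsilon>: "0 < \<epsilon>" and "X \<epsilon> a < X \<epsilon> l" "X \<epsilon> r < X \<epsilon> b" for \<epsilon>
  proof (rule upper_L1_mono[OF _ error[OF \<epsilon>]])
    show "upper_L1 (A \<epsilon>) (\<integral>\<^sup>+ s. ennreal (indicator {a..b} s * \<bar>W \<epsilon> s - v s * X' \<epsilon> s\<bar>) \<partial>lborel)"
      unfolding A_def v_def
    proof (rule smeared_limit_bound[where M = "M * t" and N = N])
      show "(X \<epsilon> has_real_derivative X' \<epsilon> s) (at s)" for s
        unfolding X_def X'_def by (auto intro!: derivative_eq_intros U_deriv(1)[OF \<epsilon>])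
      show "continuous_on UNIV (X' \<epsilon>)"
        unfolding X'_def by (intro continuous_intros U_deriv(2)[OF \<epsilon>])
      show "W \<epsilon> \<in> borel_measurable lborel"
        using borel_measurable_continuous_onI[OF W_cont[OF \<epsilon>]] by simp
      show "\<bar>X \<epsilon> s - s\<bar> \<le> M * t" for s
        using U_bound[OF \<epsilon>, of s] t by (simp add: X_def abs_mult)
      show "((\<lambda>\<tau>. LBINT s. W \<epsilon> s * normal_density x \<tau> (X \<epsilon> s)) \<longlongrightarrow> H x \<epsilon>) (at_right 0)" if "x \<in> S \<epsilon>" for x
      proof -
        have "filterlim (\<lambda>\<tau>. \<tau> / sqrt t) (at_right 0) (at_right 0)"
          using t unfolding filterlim_at
          by (auto intro!: tendsto_eq_intros eventually_mono[OF eventually_at_right_less[of 0]])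
        with that have "((\<lambda>\<tau>. particle_density (W \<epsilon>) (U \<epsilon>) (\<tau> / sqrt t) t x) \<longlongrightarrow> H x \<epsilon>) (at_right 0)"
          unfolding S_def by (auto intro: filterlim_compose)
        then show ?thesis
          by (rule Lim_transform_eventually)
             (use t in \<open>auto intro!: eventually_mono[OF eventually_at_right_less[of 0]] simp: particle_density_eq_smeared X_def\<close>)
      qed
    qed (use that lr \<rho> W_bound[OF \<epsilon>] in auto)
  qed
  define e where "e n = 1 / real (Suc n)" for n
  have e: "filterlim e (at_right 0) sequentially"
    unfolding e_def by (rule inverse_Suc_tendsto_at_right_0)
  show ?thesis
  proof (rule upper_L1_Fatou)
    have "\<forall>\<^sub>F \<epsilon> in at_right 0. 0 < X \<epsilon> l - X \<epsilon> a" "\<forall>\<^sub>F \<epsilon> in at_right 0. 0 < X \<epsilon> b - X \<epsilon> r"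
      by (rule order_tendstoD(1)[OF tendsto_diff[OF X_lim(2,1)]] order_tendstoD(1)[OF tendsto_diff[OF X_lim(4,3)]]; use lr in simp)+
    with eventually_at_right_less[of 0] have "\<forall>\<^sub>F \<epsilon> in at_right 0. upper_L1 (A \<epsilon>) (ennreal (\<delta> \<epsilon>))"
      by eventually_elim (auto intro: A)
    then show "\<forall>\<^sub>F n in sequentially. upper_L1 (A (e n)) (ennreal (\<delta> (e n)))"
      using e by (auto simp: filterlim_iff)
    show "(\<lambda>n. ennreal (\<delta> (e n))) \<longlonglongrightarrow> ennreal (N * (r - l))"
      by (intro tendsto_ennrealI filterlim_compose[OF \<delta>_lim e])
    have "AE x in lborel. x \<notin> {a + c\<^sub>1 * t, l + c\<^sub>1 * t, r + c\<^sub>2 * t, b + c\<^sub>2 * t}"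
      by (intro AE_not_in finite_imp_null_set_lborel) simp
    with h show "AE x in lborel. (if \<bar>x\<bar> \<le> \<rho> then h x - w\<^sub>1 * indicator {a + c\<^sub>1 * t<..<l + c\<^sub>1 * t} x
      - w\<^sub>2 * indicator {r + c\<^sub>2 * t<..<b + c\<^sub>2 * t} x else 0) = 0 \<or>
      (\<lambda>n. A (e n) x) \<longlonglongrightarrow> (if \<bar>x\<bar> \<le> \<rho> then h x - w\<^sub>1 * indicator {a + c\<^sub>1 * t<..<l + c\<^sub>1 * t} x
      - w\<^sub>2 * indicator {r + c\<^sub>2 * t<..<b + c\<^sub>2 * t} x else 0)"
    proof eventually_elim
      case (elim x)
      show ?case
      proof (cases "\<bar>x\<bar> \<le> \<rho>")
        case True
        from H[rule_format, OF elim(1)] have Hx: "\<forall>\<^sub>F \<epsilon> in at_right 0. x \<in> S \<epsilon>" "(H x \<longlongrightarrow> h x) (at_right 0)"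
          by (auto simp: S_def)
        have "((\<lambda>\<epsilon>. H x \<epsilon> - w\<^sub>1 * indicator {X \<epsilon> a<..<X \<epsilon> l} x - w\<^sub>2 * indicator {X \<epsilon> r<..<X \<epsilon> b} x) \<longlongrightarrow>
            h x - w\<^sub>1 * indicator {a + c\<^sub>1 * t<..<l + c\<^sub>1 * t} x - w\<^sub>2 * indicator {r + c\<^sub>2 * t<..<b + c\<^sub>2 * t} x) (at_right 0)"
          using elim(2) by (intro tendsto_intros Hx tendsto_indicator_greaterThanLessThan X_lim) auto
        then have "((\<lambda>\<epsilon>. A \<epsilon> x) \<longlongrightarrow>
            h x - w\<^sub>1 * indicator {a + c\<^sub>1 * t<..<l + c\<^sub>1 * t} x - w\<^sub>2 * indicator {r + c\<^sub>2 * t<..<b + c\<^sub>2 * t} x) (at_right 0)"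
          by (rule Lim_transform_eventually) (use Hx(1) True in \<open>auto elim!: eventually_mono simp: A_def\<close>)
        from filterlim_compose[OF this e] True show ?thesis by simp
      qed simp
    qed
  qed
qed

text \<open>
  Let the blocks exhaust the two half-lines.  The gap between them shrinks to the jump, so the error
  tends to 0, and the two image blocks grow to the half-lines left of \<open>c\<^sub>1 t\<close> and right of \<open>c\<^sub>2 t\<close>.
\<close>

lemma density_eq_step:
  assumes t: "0 < t"
    and h: "AE x in lborel. has_iterated_limit (\<lambda>\<epsilon> \<sigma>. particle_density (W \<epsilon>) (U \<epsilon>) \<sigma> t x) (h x)"
  shows "AE x in lborel. h x = w\<^sub>1 * indicator {..<c\<^sub>1 * t} x + w\<^sub>2 * indicator {c\<^sub>2 * t..} x"
proof -
  define R where "R k = 2 * (real (Suc k) + M * t)" for k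
  have "0 \<le> M * t" using M_nonneg t by simp
  then have R: "1 < R k" for k unfolding R_def by (simp add: algebra_simps)
  have inv: "0 < 1 / real (Suc k)" "1 / real (Suc k) \<le> 1" for k by simp_all
  \<comment> \<open>The end points of the blocks have to be points at which the smoothed velocity converges; these are dense.\<close>
  have "\<exists>a. - R k - 1 < a \<and> a < - R k \<and> ((\<lambda>\<epsilon>. U \<epsilon> a) \<longlongrightarrow> (if a < 0 then c\<^sub>1 else c\<^sub>2)) (at_right 0)"
    "\<exists>l. - (1 / real (Suc k)) < l \<and> l < 0 \<and> ((\<lambda>\<epsilon>. U \<epsilon> l) \<longlongrightarrow> (if l < 0 then c\<^sub>1 else c\<^sub>2)) (at_right 0)"
    "\<exists>r. 0 < r \<and> r < 1 / real (Suc k) \<and> ((\<lambda>\<epsilon>. U \<epsilon> r) \<longlongrightarrow> (if r < 0 then c\<^sub>1 else c\<^sub>2)) (at_right 0)"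
    "\<exists>b. R k < b \<and> b < R k + 1 \<and> ((\<lambda>\<epsilon>. U \<epsilon> b) \<longlongrightarrow> (if b < 0 then c\<^sub>1 else c\<^sub>2)) (at_right 0)" for k
    using inv[of k] by (intro AE_lborel_exists_between[OF U_lim]; simp)+
  then obtain a l r b where
      a: "\<And>k. - R k - 1 < a k" "\<And>k. a k < - R k" "\<And>k. ((\<lambda>\<epsilon>. U \<epsilon> (a k)) \<longlongrightarrow> (if a k < 0 then c\<^sub>1 else c\<^sub>2)) (at_right 0)"
    and l: "\<And>k. - (1 / real (Suc k)) < l k" "\<And>k. l k < 0" "\<And>k. ((\<lambda>\<epsilon>. U \<epsilon> (l k)) \<longlongrightarrow> (if l k < 0 then c\<^sub>1 else c\<^sub>2)) (at_right 0)"
    and r: "\<And>k. 0 < r k" "\<And>k. r k < 1 / real (Suc k)" "\<And>k. ((\<lambda>\<epsilon>. U \<epsilon> (r k)) \<longlongrightarrow> (if r k < 0 then c\<^sub>1 else c\<^sub>2)) (at_right 0)"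
    and b: "\<And>k. R k < b k" "\<And>k. b k < R k + 1" "\<And>k. ((\<lambda>\<epsilon>. U \<epsilon> (b k)) \<longlongrightarrow> (if b k < 0 then c\<^sub>1 else c\<^sub>2)) (at_right 0)"
    by metis
  have neg: "a k < 0" "0 < b k" "a k < l k" "r k < b k" for k
    using a(2)[of k] b(1)[of k] R[of k] l(1)[of k] r(2)[of k] inv[of k] by linarith+
  have step: "upper_L1 (\<lambda>x. if \<bar>x\<bar> \<le> real (Suc k) then h x - w\<^sub>1 * indicator {a k + c\<^sub>1 * t<..<l k + c\<^sub>1 * t} x
      - w\<^sub>2 * indicator {r k + c\<^sub>2 * t<..<b k + c\<^sub>2 * t} x else 0) (ennreal (N * (r k - l k)))" for k
    by (rule density_near_step[OF t neg(3) l(2) r(1) neg(4) _ _ _ _ _ _ _ h])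
       (use a[of k] l[of k] r[of k] b[of k] neg[of k] in \<open>auto simp: R_def\<close>)
  have lim0: "l \<longlonglongrightarrow> 0" "r \<longlonglongrightarrow> 0"
  proof -
    have "(\<lambda>k. 1 / real (Suc k)) \<longlonglongrightarrow> 0" using LIMSEQ_Suc[OF lim_1_over_n] by simp
    then have inv0: "(\<lambda>k. 1 / real (Suc k)) \<longlonglongrightarrow> 0" "(\<lambda>k. - (1 / real (Suc k))) \<longlonglongrightarrow> 0"
      using tendsto_minus[of "\<lambda>k. 1 / real (Suc k)" 0] by simp_all
    show "l \<longlonglongrightarrow> 0"
      by (rule tendsto_sandwich[OF _ _ inv0(2) tendsto_const]) (use l in \<open>auto intro!: always_eventually less_imp_le simp del: of_nat_Suc\<close>)
    show "r \<longlonglongrightarrow> 0"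
      by (rule tendsto_sandwich[OF _ _ tendsto_const inv0(1)]) (use r in \<open>auto intro!: always_eventually less_imp_le simp del: of_nat_Suc\<close>)
  qed
  have inf: "filterlim R at_top sequentially"
  proof (rule filterlim_at_top_mono[OF filterlim_real_sequentially])
    show "\<forall>\<^sub>F k in sequentially. real k \<le> R k"
      using M_nonneg t by (auto simp: R_def)
  qed
  have "upper_L1 (\<lambda>x. h x - w\<^sub>1 * indicator {..<c\<^sub>1 * t} x - w\<^sub>2 * indicator {c\<^sub>2 * t..} x) 0"
  proof (rule upper_L1_Fatou[OF always_eventually[OF allI[OF step]]])
    have "(\<lambda>k. ennreal (N * (r k - l k))) \<longlonglongrightarrow> ennreal (N * (0 - 0))"
      by (intro tendsto_ennrealI tendsto_intros lim0)
    then show "(\<lambda>k. ennreal (N * (r k - l k))) \<longlonglongrightarrow> 0" by simp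
    have "AE x in lborel. x \<notin> {c\<^sub>1 * t, c\<^sub>2 * t}"
      by (intro AE_not_in finite_imp_null_set_lborel) simp
    then show "AE x in lborel. h x - w\<^sub>1 * indicator {..<c\<^sub>1 * t} x - w\<^sub>2 * indicator {c\<^sub>2 * t..} x = 0 \<or>
      (\<lambda>k. if \<bar>x\<bar> \<le> real (Suc k) then h x - w\<^sub>1 * indicator {a k + c\<^sub>1 * t<..<l k + c\<^sub>1 * t} x
      - w\<^sub>2 * indicator {r k + c\<^sub>2 * t<..<b k + c\<^sub>2 * t} x else 0) \<longlonglongrightarrow> h x - w\<^sub>1 * indicator {..<c\<^sub>1 * t} x - w\<^sub>2 * indicator {c\<^sub>2 * t..} x"
    proof (eventually_elim, intro disjI2 tendsto_eventually)
      fix x assume x: "x \<notin> {c\<^sub>1 * t, c\<^sub>2 * t}"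
      have "\<forall>\<^sub>F k in sequentially. \<bar>x\<bar> + \<bar>c\<^sub>1 * t\<bar> + \<bar>c\<^sub>2 * t\<bar> < R k"
        using inf by (simp add: filterlim_at_top_dense)
      moreover have "\<forall>\<^sub>F k in sequentially. \<bar>x\<bar> < real k"
        using filterlim_real_sequentially by (simp add: filterlim_at_top_dense)
      moreover have "\<forall>\<^sub>F k in sequentially. x - c\<^sub>1 * t < l k \<longleftrightarrow> x - c\<^sub>1 * t < 0"
      proof (cases "x - c\<^sub>1 * t < 0")
        case True
        from order_tendstoD(1)[OF lim0(1) this] True show ?thesis by (auto elim: eventually_mono)
      next
        case False
        have "\<not> x - c\<^sub>1 * t < l k" for k using False l(2)[of k] by linarith
        with False show ?thesis by simp
      qed
      moreover have "\<forall>\<^sub>F k in sequentially. r k < x - c\<^sub>2 * t \<longleftrightarrow> 0 < x - c\<^sub>2 * t"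
      proof (cases "0 < x - c\<^sub>2 * t")
        case True
        from order_tendstoD(2)[OF lim0(2) this] True show ?thesis by (auto elim: eventually_mono)
      next
        case False
        have "\<not> r k < x - c\<^sub>2 * t" for k using False r(1)[of k] by linarith
        with False show ?thesis by simp
      qed
      ultimately show "\<forall>\<^sub>F k in sequentially. (if \<bar>x\<bar> \<le> real (Suc k) then h x - w\<^sub>1 * indicator {a k + c\<^sub>1 * t<..<l k + c\<^sub>1 * t} x
      - w\<^sub>2 * indicator {r k + c\<^sub>2 * t<..<b k + c\<^sub>2 * t} x else 0) = h x - w\<^sub>1 * indicator {..<c\<^sub>1 * t} x - w\<^sub>2 * indicator {c\<^sub>2 * t..} x"
      proof eventually_elim
        case (elim k)
        have "a k + c\<^sub>1 * t < x" "x < b k + c\<^sub>2 * t"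
          using elim(1) a(2)[of k] b(1)[of k] by linarith+
        moreover have "x < l k + c\<^sub>1 * t \<longleftrightarrow> x < c\<^sub>1 * t" "r k + c\<^sub>2 * t < x \<longleftrightarrow> c\<^sub>2 * t \<le> x"
          using elim(3,4) x by auto
        ultimately show ?case using elim(2) by (simp add: indicator_def)
      qed
    qed
  qed
  from upper_L1_zero[OF this] show ?thesis by eventually_elim simp
qed

end

section \<open>Transported waves as weak solutions\<close>

lemma borel_measurable_lebesgue_cong_AE:
  fixes q s :: "'a::euclidean_space \<Rightarrow> real"
  assumes s: "s \<in> borel_measurable borel" and ae: "AE z in lborel. q z = s z"
  shows "q \<in> borel_measurable lebesgue"
proof (rule measurableI)
  fix B :: "real set" assume "B \<in> sets borel"
  have "s \<in> borel_measurable lebesgue" using s by (intro measurable_completion) simp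
  then have s': "s -` B \<in> sets lebesgue"
    using measurable_sets[of s lebesgue borel B] \<open>B \<in> sets borel\<close> by simp
  have "AE z in lebesgue. q z = s z" using ae by (rule AE_completion)
  then have "AE z in lebesgue. z \<in> s -` B \<longleftrightarrow> z \<in> q -` B" by eventually_elim simp
  from completion.in_sets_AE[OF this s'] show "q -` B \<inter> space lebesgue \<in> sets lebesgue" by simp
qed simp

lemma
  assumes "test_function \<phi>"
  shows test_function_differentiable: "\<phi> differentiable (at z)"
    and test_function_continuous_dt: "continuous_on UNIV (dt \<phi>)"
    and test_function_continuous_dx: "continuous_on UNIV (dx \<phi>)"
proof -
  have "Ck (Suc 0) \<phi>" using assms unfolding test_function_def by blast
  then show "\<phi> differentiable (at z)" "continuous_on UNIV (dt \<phi>)" "continuous_on UNIV (dx \<phi>)"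
    unfolding Ck.simps by blast+
qed

lemma test_function_has_derivative:
  assumes "test_function \<phi>"
  shows "(\<phi> has_derivative (\<lambda>h. fst h * dt \<phi> z + snd h * dx \<phi> z)) (at z)"
proof -
  obtain t x where z: "z = (t, x)" by (cases z)
  from test_function_differentiable[OF assms] obtain D where D: "(\<phi> has_derivative D) (at (t, x))"
    unfolding differentiable_def by blast
  then interpret D: bounded_linear D by (rule has_derivative_bounded_linear)
  define \<alpha> \<beta> where "\<alpha> = D (1, 0)" and "\<beta> = D (0, 1)"
  have D1: "D (h, 0) = \<alpha> * h" and D2: "D (0, h) = \<beta> * h" for h
    using D.scaleR[of h "(1, 0)"] D.scaleR[of h "(0, 1)"] by (simp_all add: \<alpha>_def \<beta>_def)
  have "((\<lambda>s. \<phi> (s, x)) has_derivative (\<lambda>h. D (h, 0))) (at t)"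
    by (rule has_derivative_compose[where f = "\<lambda>s. (s, x)" and f' = "\<lambda>h. (h, 0)" and g = \<phi> and g' = D, OF _ D])
       (auto intro!: derivative_eq_intros)
  then have "((\<lambda>s. \<phi> (s, x)) has_real_derivative \<alpha>) (at t)"
    unfolding has_field_derivative_def D1 .
  then have 1: "dt \<phi> z = \<alpha>" by (simp add: dt_def z DERIV_imp_deriv)
  have "((\<lambda>y. \<phi> (t, y)) has_derivative (\<lambda>h. D (0, h))) (at x)"
    by (rule has_derivative_compose[where f = "\<lambda>y. (t, y)" and f' = "\<lambda>h. (0, h)" and g = \<phi> and g' = D, OF _ D])
       (auto intro!: derivative_eq_intros)
  then have "((\<lambda>y. \<phi> (t, y)) has_real_derivative \<beta>) (at x)"
    unfolding has_field_derivative_def D2 .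
  then have 2: "dx \<phi> z = \<beta>" by (simp add: dx_def z DERIV_imp_deriv)
  have "D h = fst h * dt \<phi> z + snd h * dx \<phi> z" for h
    using D.add[of "(fst h, 0)" "(0, snd h)"] D1[of "fst h"] D2[of "snd h"]
    by (simp add: 1 2 mult.commute)
  then have "D = (\<lambda>h. fst h * dt \<phi> z + snd h * dx \<phi> z)" by (rule ext)
  then show ?thesis using D by (simp only: z)
qed

lemma test_function_outside:
  assumes "test_function \<phi>" "z \<notin> closure {z. \<phi> z \<noteq> 0}"
  shows "\<phi> z = 0" "dt \<phi> z = 0" "dx \<phi> z = 0"
proof -
  show "\<phi> z = 0" using assms(2) closure_subset[of "{z. \<phi> z \<noteq> 0}"] by auto
  have "(\<phi> has_derivative (\<lambda>_. 0)) (at z)"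
  proof (rule has_derivative_transform_within_open)
    show "((\<lambda>_. 0) has_derivative (\<lambda>_. 0)) (at z)" by simp
    show "open (- closure {z. \<phi> z \<noteq> 0})" by auto
    show "0 = \<phi> y" if "y \<in> - closure {z. \<phi> z \<noteq> 0}" for y
      using that closure_subset[of "{z. \<phi> z \<noteq> 0}"] by auto
  qed (use assms in auto)
  from has_derivative_unique[OF this test_function_has_derivative[OF assms(1)]]
  have "fst h * dt \<phi> z + snd h * dx \<phi> z = 0" for h by metis
  from this[of "(1, 0)"] this[of "(0, 1)"] show "dt \<phi> z = 0" "dx \<phi> z = 0" by auto
qed

lemma integrable_bounded_compact_support:
  fixes g :: "'a::euclidean_space \<Rightarrow> real"
  assumes "g \<in> borel_measurable borel" "compact K" "\<And>z. z \<notin> K \<Longrightarrow> g z = 0" "\<And>z. \<bar>g z\<bar> \<le> B"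
  shows "integrable lborel g"
  by (rule integrableI_bounded_set[where A = K and B = B])
     (use assms emeasure_compact_finite[OF assms(2)] in \<open>auto intro: borel_compact\<close>)

lemma measurable_fst_snd_borel [measurable]:
  "fst \<in> borel_measurable (borel :: (real \<times> real) measure)"
  "snd \<in> borel_measurable (borel :: (real \<times> real) measure)"
  by (auto intro!: borel_measurable_continuous_onI continuous_intros)

text \<open>
  A wave \<open>\<eta> (x - c t)\<close> solves \<open>q\<^sub>t + c q\<^sub>x = 0\<close>: in the variable \<open>y = x - c t\<close> the inner integral over \<open>t\<close>
  is that of the derivative of \<open>\<phi>\<close> along the characteristic, and \<open>\<phi>\<close> has compact support.
\<close>

lemma transport_weak:
  fixes \<eta> :: "real \<Rightarrow> real"
  assumes \<phi>: "test_function \<phi>" and \<eta> [measurable]: "\<eta> \<in> borel_measurable borel" and B: "\<And>y. \<bar>\<eta> y\<bar> \<le> B"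
  shows "integrable lborel (\<lambda>(t, x). \<eta> (x - c * t) * (dt \<phi> (t, x) + c * dx \<phi> (t, x)))"
    and "(LINT (t, x)|lborel. \<eta> (x - c * t) * (dt \<phi> (t, x) + c * dx \<phi> (t, x))) = 0"
proof -
  let ?K = "closure {z. \<phi> z \<noteq> 0}"
  define \<psi> where "\<psi> z = dt \<phi> z + c * dx \<phi> z" for z
  have K: "compact ?K" using \<phi> by (simp add: test_function_def)
  have \<psi>0: "\<psi> z = 0" if "z \<notin> ?K" for z using test_function_outside[OF \<phi> that] by (simp add: \<psi>_def)
  have \<psi>_cont: "continuous_on UNIV \<psi>"
    unfolding \<psi>_def using test_function_continuous_dt[OF \<phi>] test_function_continuous_dx[OF \<phi>]
    by (intro continuous_intros)
  then have [measurable]: "\<psi> \<in> borel_measurable borel" by (rule borel_measurable_continuous_onI)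
  have "bounded (\<psi> ` ?K)"
    by (rule compact_imp_bounded[OF compact_continuous_image[OF continuous_on_subset[OF \<psi>_cont] K]]) simp
  then obtain C where C: "0 < C" "\<And>z. z \<in> ?K \<Longrightarrow> \<bar>\<psi> z\<bar> \<le> C" by (auto simp: bounded_pos)
  have C': "\<bar>\<psi> z\<bar> \<le> C" for z using C \<psi>0[of z] by (cases "z \<in> ?K") auto
  have B0: "0 \<le> B" using B[of 0] by linarith
  have int1: "integrable lborel (\<lambda>z. \<eta> (snd z - c * fst z) * \<psi> z)"
    by (rule integrable_bounded_compact_support[OF _ K, where B = "B * C"])
       (use \<psi>0 B C' B0 in \<open>auto simp: abs_mult intro!: mult_mono\<close>)
  then show "integrable lborel (\<lambda>(t, x). \<eta> (x - c * t) * (dt \<phi> (t, x) + c * dx \<phi> (t, x)))"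
    by (simp add: case_prod_beta' \<psi>_def)
  let ?S = "\<lambda>z. (fst z, snd z - c * fst z)"
  have int2: "integrable (lborel \<Otimes>\<^sub>M lborel) (\<lambda>(t, y). \<eta> y * \<psi> (t, y + c * t))"
  proof -
    have "integrable lborel (\<lambda>z. \<eta> (snd z) * \<psi> (fst z, snd z + c * fst z))"
    proof (rule integrable_bounded_compact_support[where K = "?S ` ?K" and B = "B * C"])
      show "compact (?S ` ?K)" by (intro compact_continuous_image K continuous_intros)
      show "\<eta> (snd z) * \<psi> (fst z, snd z + c * fst z) = 0" if "z \<notin> ?S ` ?K" for z
      proof -
        have "(fst z, snd z + c * fst z) \<notin> ?K"
          using that by (metis (no_types, lifting) add_diff_cancel_right' fst_conv image_eqI prod.collapse snd_conv)
        then show ?thesis by (simp add: \<psi>0)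
      qed
    qed (use B C' B0 in \<open>auto simp: abs_mult intro!: mult_mono\<close>)
    then show ?thesis by (simp add: lborel_prod case_prod_beta')
  qed
  have inner: "(LBINT t. \<psi> (t, y + c * t)) = 0" for y
  proof -
    obtain R where R: "0 < R" "\<And>z. z \<in> ?K \<Longrightarrow> norm z \<le> R" using compact_imp_bounded[OF K] by (auto simp: bounded_pos)
    have out: "(t, x) \<notin> ?K" if "R < \<bar>t\<bar>" for t x
      using R(2)[of "(t, x)"] norm_fst_le[of t x] that by auto
    have d: "((\<lambda>t. \<phi> (t, y + c * t)) has_real_derivative \<psi> (t, y + c * t)) (at t)" for t
    proof -
      have "((\<lambda>t. (t, y + c * t)) has_derivative (\<lambda>h. (h, c * h))) (at t)"
        by (auto intro!: derivative_eq_intros)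
      from has_derivative_compose[OF this test_function_has_derivative[OF \<phi>]]
      have "((\<lambda>t. \<phi> (t, y + c * t)) has_derivative (\<lambda>h. h * dt \<phi> (t, y + c * t) + c * h * dx \<phi> (t, y + c * t))) (at t)"
        by simp
      moreover have "(\<lambda>h. h * dt \<phi> (t, y + c * t) + c * h * dx \<phi> (t, y + c * t)) = (*) (\<psi> (t, y + c * t))"
        by (simp add: \<psi>_def fun_eq_iff algebra_simps)
      ultimately show ?thesis by (simp add: has_field_derivative_def)
    qed
    have "(LBINT t. \<psi> (t, y + c * t)) = (LBINT t. indicator {-(R+1)..R+1} t *\<^sub>R \<psi> (t, y + c * t))"
    proof (rule Bochner_Integration.integral_cong[OF refl])
      fix t
      show "\<psi> (t, y + c * t) = indicator {-(R+1)..R+1} t *\<^sub>R \<psi> (t, y + c * t)"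
      proof (cases "t \<in> {-(R+1)..R+1}")
        case False
        then have "R < \<bar>t\<bar>" by auto
        from \<psi>0[OF out[OF this]] show ?thesis by simp
      qed simp
    qed
    also have "\<dots> = \<phi> (R+1, y + c * (R+1)) - \<phi> (-(R+1), y + c * (-(R+1)))"
      by (rule integral_FTC_Icc)
         (use R(1) d in \<open>auto intro!: continuous_on_compose2[OF \<psi>_cont] continuous_intros
            simp: has_real_derivative_iff_has_vector_derivative[symmetric] intro: has_field_derivative_at_within\<close>)
    also have "\<dots> = 0"
      using test_function_outside(1)[OF \<phi> out] R(1) by simp
    finally show ?thesis .
  qed
  have "(LINT (t, x)|lborel. \<eta> (x - c * t) * (dt \<phi> (t, x) + c * dx \<phi> (t, x)))
      = (LINT (t, x)|(lborel \<Otimes>\<^sub>M lborel). \<eta> (x - c * t) * \<psi> (t, x))"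
    by (simp add: \<psi>_def lborel_prod)
  also have "\<dots> = (LBINT t. LBINT x. \<eta> (x - c * t) * \<psi> (t, x))"
    using int1 by (subst lborel_pair.integral_fst'[symmetric]) (auto simp: lborel_prod case_prod_beta')
  also have "\<dots> = (LBINT t. LBINT y. \<eta> y * \<psi> (t, y + c * t))"
  proof (rule Bochner_Integration.integral_cong[OF refl])
    fix t
    show "(LBINT x. \<eta> (x - c * t) * \<psi> (t, x)) = (LBINT y. \<eta> y * \<psi> (t, y + c * t))"
      by (subst lborel_integral_real_affine[of 1 _ "c * t"]) (auto simp: add.commute)
  qed
  also have "\<dots> = (LBINT y. LBINT t. \<eta> y * \<psi> (t, y + c * t))"
    using lborel_pair.Fubini_integral[OF int2] by simp
  also have "\<dots> = 0" by (simp add: inner)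
  finally show "(LINT (t, x)|lborel. \<eta> (x - c * t) * (dt \<phi> (t, x) + c * dx \<phi> (t, x))) = 0" .
qed

lemma set_integrable_lebesgue_cong_AE:
  fixes s :: "real \<times> real \<Rightarrow> real"
  assumes s [measurable]: "s \<in> borel_measurable borel" and B: "\<And>z. \<bar>s z\<bar> \<le> B"
    and ae: "AE z in lborel. 0 < fst z \<longrightarrow> q z = s z"
    and K: "compact K" "K \<subseteq> half_plane"
  shows "set_integrable lebesgue K q"
proof -
  have [measurable]: "K \<in> sets borel" using K by (simp add: borel_compact)
  have "AE z in lborel. indicator K z *\<^sub>R q z = indicator K z *\<^sub>R s z"
    using ae by eventually_elim (use K(2) in \<open>auto simp: half_plane_def indicator_def\<close>)
  note ae = this
  have "(\<lambda>z. indicator K z *\<^sub>R s z) \<in> borel_measurable borel" by measurable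
  from borel_measurable_lebesgue_cong_AE[OF this ae]
  have m: "(\<lambda>z. indicator K z *\<^sub>R q z) \<in> borel_measurable lebesgue" .
  from ae have ae': "AE z in lebesgue. indicator K z *\<^sub>R q z = indicator K z *\<^sub>R s z"
    by (rule AE_completion)
  have "integrable lborel (\<lambda>z. indicator K z *\<^sub>R s z)"
    by (rule integrable_bounded_compact_support[OF _ K(1), where B = B])
       (use B in \<open>auto simp: indicator_def intro: order_trans[OF abs_ge_zero]\<close>)
  then have "integrable lebesgue (\<lambda>z. indicator K z *\<^sub>R s z)" by (subst integrable_completion) auto
  with m ae' show ?thesis
    unfolding set_integrable_def by (subst integrable_cong_AE) (auto intro: borel_measurable_integrable)
qed

text \<open>
  The superposition of a density \<open>a\<close> moving with velocity \<open>c\<^sub>1\<close> from the left half-line and a density \<open>b\<close>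
  moving with velocity \<open>c\<^sub>2\<close> from the right half-line, passing freely through each other when \<open>c\<^sub>2 < c\<^sub>1\<close>.
  Closing the right stream makes the pressure identity below hold also on the two rays.
\<close>

definition two_streams :: "real \<Rightarrow> real \<Rightarrow> real \<Rightarrow> real \<Rightarrow> real \<times> real \<Rightarrow> real" where
  "two_streams c\<^sub>1 c\<^sub>2 a b = (\<lambda>(t, x). a * indicator {..<c\<^sub>1 * t} x + b * indicator {c\<^sub>2 * t..} x)"

lemma two_streams_measurable [measurable]: "two_streams c\<^sub>1 c\<^sub>2 a b \<in> borel_measurable borel"
proof -
  have "two_streams c\<^sub>1 c\<^sub>2 a b = (\<lambda>z. a * indicator {..<0} (snd z - c\<^sub>1 * fst z) + b * indicator {0..} (snd z - c\<^sub>2 * fst z))"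
    by (auto simp: two_streams_def indicator_def)
  then show ?thesis by simp
qed

lemma two_streams_bounded: "\<bar>two_streams c\<^sub>1 c\<^sub>2 a b z\<bar> \<le> \<bar>a\<bar> + \<bar>b\<bar>"
  by (cases z) (auto simp: two_streams_def indicator_def)

text \<open>
  Each stream is transported by its own velocity, hence has the flux \<open>a c\<^sub>1\<close> or \<open>b c\<^sub>2\<close>.
\<close>

lemma weak_conservation_law_two_streams:
  assumes q: "AE (t, x) in lborel. 0 < t \<longrightarrow> q t x = two_streams c\<^sub>1 c\<^sub>2 a b (t, x)"
    and j: "AE (t, x) in lborel. 0 < t \<longrightarrow> j t x = two_streams c\<^sub>1 c\<^sub>2 (a * c\<^sub>1) (b * c\<^sub>2) (t, x)"
  shows "weak_conservation_law q j"
  unfolding weak_conservation_law_def locally_integrable_def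
proof (intro conjI allI impI)
  fix K :: "(real \<times> real) set" assume K: "compact K \<and> K \<subseteq> half_plane"
  show "set_integrable lebesgue K (\<lambda>(t, x). q t x)"
    by (rule set_integrable_lebesgue_cong_AE[OF two_streams_measurable two_streams_bounded])
       (use q K in \<open>auto simp: case_prod_beta'\<close>)
  show "set_integrable lebesgue K (\<lambda>(t, x). j t x)"
    by (rule set_integrable_lebesgue_cong_AE[OF two_streams_measurable two_streams_bounded])
       (use j K in \<open>auto simp: case_prod_beta'\<close>)
next
  fix \<phi> assume \<phi>: "test_function \<phi>"
  let ?q = "two_streams c\<^sub>1 c\<^sub>2 a b" and ?j = "two_streams c\<^sub>1 c\<^sub>2 (a * c\<^sub>1) (b * c\<^sub>2)"
  let ?l = "\<lambda>z. q (fst z) (snd z) * dt \<phi> z + j (fst z) (snd z) * dx \<phi> z"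
  let ?r = "\<lambda>z. ?q z * dt \<phi> z + ?j z * dx \<phi> z"
  have [measurable]: "dt \<phi> \<in> borel_measurable borel" "dx \<phi> \<in> borel_measurable borel"
    using test_function_continuous_dt[OF \<phi>] test_function_continuous_dx[OF \<phi>]
    by (auto intro: borel_measurable_continuous_onI)
  have r: "?r \<in> borel_measurable borel" by measurable
  have zero: "dt \<phi> z = 0 \<and> dx \<phi> z = 0" if "\<not> 0 < fst z" for z
  proof -
    have "z \<notin> closure {z. \<phi> z \<noteq> 0}"
      using \<phi> that unfolding test_function_def half_plane_def by (metis greaterThan_iff mem_Times_iff subsetD)
    from test_function_outside(2,3)[OF \<phi> this] show ?thesis by simp
  qed
  have ae: "AE z in lborel. ?l z = ?r z"
    using q j by eventually_elim (use zero in \<open>auto simp: case_prod_beta'\<close>)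
  have "(LINT (t, x)|lebesgue. q t x * dt \<phi> (t, x) + j t x * dx \<phi> (t, x)) = (LINT z|lebesgue. ?l z)"
    by (simp add: case_prod_beta')
  also have "\<dots> = (LINT z|lebesgue. ?r z)"
    using borel_measurable_lebesgue_cong_AE[OF r ae] r AE_completion[OF ae]
    by (intro integral_cong_AE) (auto intro: measurable_completion)
  also have "\<dots> = (LINT z|lborel. ?r z)"
    using r by (intro integral_completion) simp
  also have "\<dots> = (LINT z|lborel. a * (case z of (t, x) \<Rightarrow> indicator {..<0} (x - c\<^sub>1 * t) * (dt \<phi> (t, x) + c\<^sub>1 * dx \<phi> (t, x)))
      + b * (case z of (t, x) \<Rightarrow> indicator {0..} (x - c\<^sub>2 * t) * (dt \<phi> (t, x) + c\<^sub>2 * dx \<phi> (t, x))))"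
    by (intro Bochner_Integration.integral_cong) (auto simp: two_streams_def indicator_def algebra_simps)
  also have "\<dots> = 0"
    using transport_weak[OF \<phi>, of "indicator {..<0}" 1 c\<^sub>1] transport_weak[OF \<phi>, of "indicator {0..}" 1 c\<^sub>2]
    by (subst Bochner_Integration.integral_add) (auto simp: indicator_def)
  finally show "(LINT (t, x)|lebesgue. q t x * dt \<phi> (t, x) + j t x * dx \<phi> (t, x)) = 0" .
qed

section \<open>Two streams as iterated limits\<close>

text \<open>
  Iterated limits of measurable functions are measurable once they are taken along sequences.
\<close>

lemma has_iterated_limit_lim:
  assumes "has_iterated_limit h l"
  shows "lim (\<lambda>n. lim (\<lambda>m. h (1 / real (Suc n)) (1 / real (Suc m)))) = l"
proof -
  let ?e = "\<lambda>n. 1 / real (Suc n)"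
  obtain H where H: "\<forall>\<^sub>F \<epsilon> in at_right 0. (h \<epsilon> \<longlongrightarrow> H \<epsilon>) (at_right 0)" "(H \<longlongrightarrow> l) (at_right 0)"
    using assms unfolding has_iterated_limit_def by blast
  note e = inverse_Suc_tendsto_at_right_0
  have "\<forall>\<^sub>F n in sequentially. (h (?e n) \<longlongrightarrow> H (?e n)) (at_right 0)"
    using H(1) e unfolding filterlim_iff by blast
  then have "\<forall>\<^sub>F n in sequentially. H (?e n) = lim (\<lambda>m. h (?e n) (?e m))"
    by eventually_elim (rule limI[symmetric], rule filterlim_compose[OF _ e])
  with filterlim_compose[OF H(2) e] have "(\<lambda>n. lim (\<lambda>m. h (?e n) (?e m))) \<longlonglongrightarrow> l"
    by (rule Lim_transform_eventually)
  then show ?thesis by (rule limI)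
qed

lemma has_iterated_limit_mult:
  assumes "has_iterated_limit h l" "has_iterated_limit k m"
    and eq: "\<And>\<epsilon> \<sigma>. 0 < \<epsilon> \<Longrightarrow> 0 < \<sigma> \<Longrightarrow> h \<epsilon> \<sigma> * k \<epsilon> \<sigma> = g \<epsilon> \<sigma>"
  shows "has_iterated_limit g (l * m)"
proof -
  obtain H K where H: "\<forall>\<^sub>F \<epsilon> in at_right 0. (h \<epsilon> \<longlongrightarrow> H \<epsilon>) (at_right 0)" "(H \<longlongrightarrow> l) (at_right 0)"
    and K: "\<forall>\<^sub>F \<epsilon> in at_right 0. (k \<epsilon> \<longlongrightarrow> K \<epsilon>) (at_right 0)" "(K \<longlongrightarrow> m) (at_right 0)"
    using assms unfolding has_iterated_limit_def by blast
  have "\<forall>\<^sub>F \<epsilon> in at_right 0. (g \<epsilon> \<longlongrightarrow> H \<epsilon> * K \<epsilon>) (at_right 0)"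
    using H(1) K(1) eventually_at_right_less[of 0]
  proof eventually_elim
    case (elim \<epsilon>)
    from tendsto_mult[OF elim(1,2)] show ?case
      by (rule Lim_transform_eventually)
         (use elim(3) in \<open>auto intro!: eventually_mono[OF eventually_at_right_less[of 0]] eq\<close>)
  qed
  with tendsto_mult[OF H(2) K(2)] show ?thesis
    unfolding has_iterated_limit_def by (intro exI[of _ "\<lambda>\<epsilon>. H \<epsilon> * K \<epsilon>"] conjI)
qed

text \<open>
  If the denominator of the velocity is 0, the division makes the velocity 0; then the nonnegative
  weight vanishes almost everywhere, so the momentum is 0 as well.
\<close>

lemma particle_density_mult_velocity:
  assumes cont: "continuous_on UNIV F" "continuous_on UNIV U"
    and F: "\<And>s. 0 \<le> F s" "\<And>s. \<bar>F s\<bar> \<le> N" and U: "\<And>s. \<bar>U s\<bar> \<le> M" and pos: "0 < \<sigma>" "0 < t"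
  shows "particle_density F U \<sigma> t x * particle_velocity F U \<sigma> t x = particle_density (\<lambda>s. U s * F s) U \<sigma> t x"
proof (cases "particle_density F U \<sigma> t x = 0")
  case False
  then have "(LBINT s. F s * exp (- (\<bar>U s * t + s - x\<bar>\<^sup>2 / (2 * \<sigma>\<^sup>2 * t)))) \<noteq> 0"
    by (simp add: particle_density_def)
  then show ?thesis by (simp add: particle_density_def particle_velocity_def)
next
  case True
  have [measurable]: "F \<in> borel_measurable borel" "U \<in> borel_measurable borel"
    using cont by (auto intro: borel_measurable_continuous_onI)
  let ?f = "\<lambda>s. F s * normal_density x (\<sigma> * sqrt t) (s + U s * t)"
  have "integrable lborel ?f"
    by (rule integrable_smeared[where M = "M * t" and N = N]) (use F U pos in \<open>auto simp: abs_mult\<close>)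
  moreover have "integral\<^sup>L lborel ?f = 0"
    using True pos by (simp add: particle_density_eq_smeared)
  ultimately have "AE s in lborel. ?f s = 0"
    using integral_nonneg_eq_0_iff_AE[of lborel ?f] F(1) by simp
  then have "(LBINT s. U s * F s * normal_density x (\<sigma> * sqrt t) (s + U s * t)) = (LBINT s::real. 0)"
    by (intro integral_cong_AE) (auto elim: eventually_mono)
  then show ?thesis using True pos by (simp add: particle_density_eq_smeared)
qed

lemma particle_density_measurable:
  assumes [measurable]: "F \<in> borel_measurable borel" "U \<in> borel_measurable borel"
  shows "(\<lambda>z. particle_density F U \<sigma> (fst z) (snd z)) \<in> borel_measurable borel"
  unfolding particle_density_def by measurable

context jump_smoothing
begin

text \<open>
  \<open>h\<close> is not assumed to be measurable, while the passage from almost all \<open>x\<close> for almost all \<open>t\<close> to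
  almost all \<open>(t, x)\<close> requires measurability; the sequential iterated limit \<open>g\<close> takes its place.
\<close>

lemma density_eq_two_streams:
  assumes h: "AE (t, x) in lborel. 0 < t \<longrightarrow>
    has_iterated_limit (\<lambda>\<epsilon> \<sigma>. particle_density (W \<epsilon>) (U \<epsilon>) \<sigma> t x) (h t x)"
  shows "AE (t, x) in lborel. 0 < t \<longrightarrow> h t x = two_streams c\<^sub>1 c\<^sub>2 w\<^sub>1 w\<^sub>2 (t, x)"
proof -
  define g where "g z = lim (\<lambda>n. lim (\<lambda>m.
    particle_density (W (1 / real (Suc n))) (U (1 / real (Suc n))) (1 / real (Suc m)) (fst z) (snd z)))" for z
  have [measurable]: "g \<in> borel_measurable borel"
    unfolding g_def
  proof (intro borel_measurable_lim_metric particle_density_measurable)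
    fix n
    show "W (1 / real (Suc n)) \<in> borel_measurable borel"
      by (intro borel_measurable_continuous_onI W_cont) simp
    have "isCont (U (1 / real (Suc n))) s" for s
      by (rule DERIV_isCont[OF U_deriv(1)]) simp
    then show "U (1 / real (Suc n)) \<in> borel_measurable borel"
      by (intro borel_measurable_continuous_onI) (simp add: continuous_at_imp_continuous_on)
  qed
  have hg: "AE z in lborel. 0 < fst z \<longrightarrow> h (fst z) (snd z) = g z"
    using h by eventually_elim (auto simp: g_def dest: has_iterated_limit_lim)
  have "AE z in lborel \<Otimes>\<^sub>M lborel. 0 < fst z \<longrightarrow>
    has_iterated_limit (\<lambda>\<epsilon> \<sigma>. particle_density (W \<epsilon>) (U \<epsilon>) \<sigma> (fst z) (snd z)) (g z)"
    unfolding lborel_prod using h hg by eventually_elim auto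
  from lborel_pair.AE_pair[OF this]
  have "AE t in lborel. AE x in lborel. 0 < t \<longrightarrow>
    has_iterated_limit (\<lambda>\<epsilon> \<sigma>. particle_density (W \<epsilon>) (U \<epsilon>) \<sigma> t x) (g (t, x))" by simp
  then have "AE t in lborel. AE x in lborel. 0 < t \<longrightarrow> g (t, x) = two_streams c\<^sub>1 c\<^sub>2 w\<^sub>1 w\<^sub>2 (t, x)"
  proof eventually_elim
    case (elim t)
    show ?case
    proof (cases "0 < t")
      case True
      with elim show ?thesis
        using density_eq_step[OF True, of "\<lambda>x. g (t, x)"] by (simp add: two_streams_def)
    qed simp
  qed
  then have "AE z in lborel \<Otimes>\<^sub>M lborel. 0 < fst z \<longrightarrow> g z = two_streams c\<^sub>1 c\<^sub>2 w\<^sub>1 w\<^sub>2 z"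
  proof (intro lborel_pair.AE_pair_measure)
    have "Measurable.pred (borel :: (real \<times> real) measure) (\<lambda>z. 0 < fst z \<longrightarrow> g z = two_streams c\<^sub>1 c\<^sub>2 w\<^sub>1 w\<^sub>2 z)"
      by measurable
    then show "{z \<in> space (lborel \<Otimes>\<^sub>M lborel). 0 < fst z \<longrightarrow> g z = two_streams c\<^sub>1 c\<^sub>2 w\<^sub>1 w\<^sub>2 z} \<in> sets (lborel \<Otimes>\<^sub>M lborel)"
      unfolding lborel_prod by (simp add: pred_def)
  qed simp
  then show ?thesis
    unfolding lborel_prod using hg by eventually_elim auto
qed

end

text \<open>
  Between the rays both streams are present, and the momentum flux \<open>f u\<^sup>2\<close> of the mixture with its mean
  velocity misses the variance of the velocity.  For densities \<open>a, b\<close> with velocities \<open>c, d\<close> the defect is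
  \<open>a c\<^sup>2 + b d\<^sup>2 - (a c + b d)\<^sup>2 / (a + b) = a b (c - d)\<^sup>2 / (a + b)\<close>, which is the pressure.
  Where \<open>f = 0\<close> the velocity is arbitrary, but it enters only through the product with \<open>f\<close>.
\<close>

lemma two_streams_pressure:
  fixes f\<^sub>1 f\<^sub>2 u\<^sub>1 u\<^sub>2 f u t x :: real
  assumes "0 \<le> f\<^sub>1" "0 \<le> f\<^sub>1 + f\<^sub>2" "\<not> (f\<^sub>1 = 0 \<and> f\<^sub>1 + f\<^sub>2 = 0)" "u\<^sub>2 < 0" "0 < t"
    and f: "f = two_streams u\<^sub>1 (u\<^sub>1 + u\<^sub>2) f\<^sub>1 (f\<^sub>1 + f\<^sub>2) (t, x)"
    and fu: "f * u = two_streams u\<^sub>1 (u\<^sub>1 + u\<^sub>2) (f\<^sub>1 * u\<^sub>1) ((f\<^sub>1 + f\<^sub>2) * (u\<^sub>1 + u\<^sub>2)) (t, x)"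
  shows "f * u\<^sup>2 + f\<^sub>1 * (f\<^sub>1 + f\<^sub>2) * u\<^sub>2\<^sup>2 / (2 * f\<^sub>1 + f\<^sub>2) *
      (heaviside (x - (u\<^sub>1 + u\<^sub>2) * t) - heaviside (x - u\<^sub>1 * t))
    = two_streams u\<^sub>1 (u\<^sub>1 + u\<^sub>2) (f\<^sub>1 * u\<^sub>1 * u\<^sub>1) ((f\<^sub>1 + f\<^sub>2) * (u\<^sub>1 + u\<^sub>2) * (u\<^sub>1 + u\<^sub>2)) (t, x)"
proof -
  have lt: "(u\<^sub>1 + u\<^sub>2) * t < u\<^sub>1 * t" using assms by simp
  have fu2: "f * u\<^sup>2 = f * u * u" by (simp add: power2_eq_square)
  consider "x < (u\<^sub>1 + u\<^sub>2) * t" | "(u\<^sub>1 + u\<^sub>2) * t \<le> x" "x < u\<^sub>1 * t" | "u\<^sub>1 * t \<le> x" by linarith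
  then show ?thesis
  proof cases
    case 1
    then have "f = f\<^sub>1" "f * u = f\<^sub>1 * u\<^sub>1" using f fu lt by (auto simp: two_streams_def)
    then show ?thesis using 1 lt by (auto simp: fu2 two_streams_def heaviside_def power2_eq_square)
  next
    case 2
    then have *: "f = 2 * f\<^sub>1 + f\<^sub>2" "f * u = f\<^sub>1 * u\<^sub>1 + (f\<^sub>1 + f\<^sub>2) * (u\<^sub>1 + u\<^sub>2)" using f fu by (auto simp: two_streams_def)
    have pos: "0 < 2 * f\<^sub>1 + f\<^sub>2" using assms by linarith
    with *(1) have square: "f * u\<^sup>2 = (f * u)\<^sup>2 / f" by (simp add: power2_eq_square)
    have "f * u\<^sup>2 + f\<^sub>1 * (f\<^sub>1 + f\<^sub>2) * u\<^sub>2\<^sup>2 / (2 * f\<^sub>1 + f\<^sub>2) = f\<^sub>1 * u\<^sub>1 * u\<^sub>1 + (f\<^sub>1 + f\<^sub>2) * (u\<^sub>1 + u\<^sub>2) * (u\<^sub>1 + u\<^sub>2)"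
    proof -
      have "f * u\<^sup>2 + f\<^sub>1 * (f\<^sub>1 + f\<^sub>2) * u\<^sub>2\<^sup>2 / (2 * f\<^sub>1 + f\<^sub>2)
        = ((f\<^sub>1 * u\<^sub>1 + (f\<^sub>1 + f\<^sub>2) * (u\<^sub>1 + u\<^sub>2))\<^sup>2 + f\<^sub>1 * (f\<^sub>1 + f\<^sub>2) * u\<^sub>2\<^sup>2) / (2 * f\<^sub>1 + f\<^sub>2)"
        unfolding square *(2) unfolding *(1) by (simp add: add_divide_distrib)
      also have "(f\<^sub>1 * u\<^sub>1 + (f\<^sub>1 + f\<^sub>2) * (u\<^sub>1 + u\<^sub>2))\<^sup>2 + f\<^sub>1 * (f\<^sub>1 + f\<^sub>2) * u\<^sub>2\<^sup>2
        = (f\<^sub>1 * u\<^sub>1 * u\<^sub>1 + (f\<^sub>1 + f\<^sub>2) * (u\<^sub>1 + u\<^sub>2) * (u\<^sub>1 + u\<^sub>2)) * (2 * f\<^sub>1 + f\<^sub>2)"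
        by algebra
      finally show ?thesis using pos by simp
    qed
    then show ?thesis using 2 by (simp add: two_streams_def heaviside_def)
  next
    case 3
    then have "f = f\<^sub>1 + f\<^sub>2" "f * u = (f\<^sub>1 + f\<^sub>2) * (u\<^sub>1 + u\<^sub>2)" using f fu lt by (auto simp: two_streams_def)
    then show ?thesis using 3 lt by (auto simp: fu2 two_streams_def heaviside_def power2_eq_square)
  qed
qed

theorem theorem1:
  fixes f\<^sub>1 f\<^sub>2 u\<^sub>1 u\<^sub>2 :: real
    and f u :: "real \<Rightarrow> real \<Rightarrow> real"
  assumes "0 \<le> f\<^sub>1" and "0 \<le> f\<^sub>1 + f\<^sub>2" and "\<not> (f\<^sub>1 = 0 \<and> f\<^sub>1 + f\<^sub>2 = 0)" and "u\<^sub>2 < 0"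
    and "generalized_solution (riemann_data f\<^sub>1 f\<^sub>2) (riemann_data u\<^sub>1 u\<^sub>2) f u"
  shows "solves_gas_dynamics_with_pressure f u
    (\<lambda>t x. f\<^sub>1 * (f\<^sub>1 + f\<^sub>2) * u\<^sub>2\<^sup>2 / (2 * f\<^sub>1 + f\<^sub>2) *
       (heaviside (x - (u\<^sub>1 + u\<^sub>2) * t) - heaviside (x - u\<^sub>1 * t)))"
proof -
  obtain F U where FU: "smoothed_data (riemann_data f\<^sub>1 f\<^sub>2) (riemann_data u\<^sub>1 u\<^sub>2) F U"
    and lim: "AE (t, x) in lborel. 0 < t \<longrightarrow>
           has_iterated_limit (\<lambda>\<epsilon> \<sigma>. particle_density (F \<epsilon>) (U \<epsilon>) \<sigma> t x) (f t x) \<and>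
           has_iterated_limit (\<lambda>\<epsilon> \<sigma>. particle_velocity (F \<epsilon>) (U \<epsilon>) \<sigma> t x) (u t x)"
    using assms(5) unfolding generalized_solution_def by blast
  have jump: "riemann_data a b = (\<lambda>x. if x < 0 then a else a + b)" for a b
    by (auto simp: riemann_data_def heaviside_def)
  note data = FU[unfolded smoothed_data_def jump]
  from data obtain M where bound: "\<And>\<epsilon> x. 0 < \<epsilon> \<Longrightarrow> \<bar>F \<epsilon> x\<bar> \<le> M" "\<And>\<epsilon> x. 0 < \<epsilon> \<Longrightarrow> \<bar>U \<epsilon> x\<bar> \<le> M"
    by blast
  have C1: "F \<epsilon> C1_differentiable_on UNIV" "U \<epsilon> C1_differentiable_on UNIV"
    and F_nonneg: "\<And>x. 0 \<le> F \<epsilon> x" if "0 < \<epsilon>" for \<epsilon>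
    using data that by blast+
  have F_lim: "AE x in lborel. ((\<lambda>\<epsilon>. F \<epsilon> x) \<longlongrightarrow> (if x < 0 then f\<^sub>1 else f\<^sub>1 + f\<^sub>2)) (at_right 0)"
    and U_lim: "AE x in lborel. ((\<lambda>\<epsilon>. U \<epsilon> x) \<longlongrightarrow> (if x < 0 then u\<^sub>1 else u\<^sub>1 + u\<^sub>2)) (at_right 0)"
    using data by blast+
  have U_var: "((\<lambda>\<epsilon>. LBINT s:{a..b}. \<bar>deriv (U \<epsilon>) s\<bar>) \<longlongrightarrow> 0) (at_right 0)" if "a < b" "0 \<notin> {a..b}" for a b
    using data that by blast
  have cont: "continuous_on UNIV (F \<epsilon>)" "continuous_on UNIV (U \<epsilon>)" if "0 < \<epsilon>" for \<epsilon>
    using C1[OF that] by (auto intro: C1_differentiable_imp_continuous_on)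
  interpret mass: jump_smoothing F U f\<^sub>1 "f\<^sub>1 + f\<^sub>2" u\<^sub>1 "u\<^sub>1 + u\<^sub>2" M M
    by unfold_locales (use cont bound C1 F_lim U_lim U_var in auto)
  \<comment> \<open>The momentum \<open>F U\<close> is carried by the same particles as the mass \<open>F\<close>.\<close>
  interpret momentum: jump_smoothing "\<lambda>\<epsilon> s. U \<epsilon> s * F \<epsilon> s" U "f\<^sub>1 * u\<^sub>1" "(f\<^sub>1 + f\<^sub>2) * (u\<^sub>1 + u\<^sub>2)" u\<^sub>1 "u\<^sub>1 + u\<^sub>2" M "M * M"
  proof unfold_locales
    show "\<bar>U \<epsilon> s * F \<epsilon> s\<bar> \<le> M * M" if "0 < \<epsilon>" for \<epsilon> s
      unfolding abs_mult using bound[OF that, of s] by (intro mult_mono) auto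
    show "AE s in lborel. ((\<lambda>\<epsilon>. U \<epsilon> s * F \<epsilon> s) \<longlongrightarrow>
        (if s < 0 then f\<^sub>1 * u\<^sub>1 else (f\<^sub>1 + f\<^sub>2) * (u\<^sub>1 + u\<^sub>2))) (at_right 0)"
      using F_lim U_lim
    proof eventually_elim
      case (elim s)
      from tendsto_mult[OF elim(2,1)] show ?case by (auto simp: mult.commute split: if_splits)
    qed
  qed (use cont bound C1 U_lim U_var in \<open>auto intro: continuous_intros\<close>)
  let ?TS = "two_streams u\<^sub>1 (u\<^sub>1 + u\<^sub>2)"
  have f: "AE (t, x) in lborel. 0 < t \<longrightarrow> f t x = ?TS f\<^sub>1 (f\<^sub>1 + f\<^sub>2) (t, x)"
    by (rule mass.density_eq_two_streams) (use lim in \<open>auto elim!: eventually_mono\<close>)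
  have fu: "AE (t, x) in lborel. 0 < t \<longrightarrow> f t x * u t x = ?TS (f\<^sub>1 * u\<^sub>1) ((f\<^sub>1 + f\<^sub>2) * (u\<^sub>1 + u\<^sub>2)) (t, x)"
  proof (rule momentum.density_eq_two_streams)
    show "AE (t, x) in lborel. 0 < t \<longrightarrow>
      has_iterated_limit (\<lambda>\<epsilon> \<sigma>. particle_density (\<lambda>s. U \<epsilon> s * F \<epsilon> s) (U \<epsilon>) \<sigma> t x) (f t x * u t x)"
      using lim
    proof eventually_elim
      case (elim z)
      obtain t x where z: "z = (t, x)" by (cases z)
      show ?case unfolding z prod.case
      proof
        assume "0 < t"
        with elim show "has_iterated_limit (\<lambda>\<epsilon> \<sigma>. particle_density (\<lambda>s. U \<epsilon> s * F \<epsilon> s) (U \<epsilon>) \<sigma> t x) (f t x * u t x)"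
          unfolding z by (intro has_iterated_limit_mult[OF _ _ particle_density_mult_velocity])
            (use cont F_nonneg bound in auto)
      qed
    qed
  qed
  have "AE (t, x) in lborel. 0 < t \<longrightarrow> f t x * (u t x)\<^sup>2 + f\<^sub>1 * (f\<^sub>1 + f\<^sub>2) * u\<^sub>2\<^sup>2 / (2 * f\<^sub>1 + f\<^sub>2) *
       (heaviside (x - (u\<^sub>1 + u\<^sub>2) * t) - heaviside (x - u\<^sub>1 * t))
     = ?TS (f\<^sub>1 * u\<^sub>1 * u\<^sub>1) ((f\<^sub>1 + f\<^sub>2) * (u\<^sub>1 + u\<^sub>2) * (u\<^sub>1 + u\<^sub>2)) (t, x)"
    using f fu by eventually_elim (clarify, rule two_streams_pressure[OF assms(1-4)]; blast)
  from weak_conservation_law_two_streams[OF fu this] weak_conservation_law_two_streams[OF f fu]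
  show ?thesis
    unfolding solves_gas_dynamics_with_pressure_def by (intro conjI)
qed

end
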